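(* Let $0<\alpha<2$, let $d\ge 1$ be an integer with $2-\alpha<d$, let $l,n\ge 0$ be integers, put $\delta=d+2l$, and let $s$ be an integer with $\frac{\alpha}{2}-s>-1$. Let $V$ be a solid harmonic polynomial of degree $l$ in $\mathbb{R}^d$, and define $$f(x)=(1-|x|^2)_+^{\frac{\alpha}{2}-s}\,V(x)\,P_n^{(\frac{\alpha}{2}-s,\ \frac{\delta}{2}-1)}(2|x|^2-1),\qquad x\in\mathbb{R}^d .$$ Then, for all $x$ with $|x|<1$, $$(-\Delta)^{\frac{\alpha-2}{2}}f(x)=(-1)^{1-s}\,2^{\alpha-2}\,\frac{\Gamma(n+1-s+\frac{\alpha}{2})\,\Gamma(n-1+\frac{\delta+\alpha}{2})}{\Gamma(n+1)\,\Gamma(n+1-s+\frac{\delta}{2})}\,V(x)\,P_{n+1-s}^{(\frac{\alpha}{2}-2+s,\ \frac{\delta}{2}-1)}(2|x|^2-1).$$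
   Context: A solid harmonic polynomial of degree $l$ in $\mathbb{R}^d$ is a homogeneous polynomial of degree $l$ in $d$ variables satisfying Laplace's equation (in $\mathbb{R}^2$, with polar coordinates $(r,\varphi)$, these are spanned by $V_{l,1}=r^l\cos(l\varphi)$ and $V_{l,-1}=r^l\sin(l\varphi)$). $(1-|x|^2)_+^{\gamma}$ equals $(1-|x|^2)^\gamma$ for $|x|<1$ and $0$ otherwise. For $0<\beta<d$ the Riesz potential operator is $(-\Delta)^{-\beta/2}u(x)=\frac{1}{\gamma_d(\beta)}\int_{\mathbb{R}^d}\frac{u(x-y)}{|y|^{d-\beta}}\,dy$, with $\gamma_d(\beta)=2^\beta\pi^{d/2}\Gamma(\beta/2)/\Gamma((d-\beta)/2)$. Here $(-\Delta)^{\frac{\alpha-2}{2}}$ is this operator with $\beta=2-\alpha$. Jacobi polynomials: for an integer $n\ge0$ and real $a,b$ with $b>-1$, $$P_n^{(a,b)}(t)=\frac{(-1)^n\,\Gamma(b+1+n)}{n!}\sum_{j=0}^{n}\frac{(-n)^{(j)}\,(1+a+b+n)^{(j)}}{\Gamma(b+1+j)\,j!}\left(\frac{1+t}{2}\right)^j,$$ where $c^{(j)}=c(c+1)\cdots(c+j-1)$, $c^{(0)}=1$ (this is the usual Jacobi polynomial, with the usual polynomial extension in the parameter $a$). *)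

theory Defs
  imports "HOL-Analysis.Analysis"
begin

definition homogeneous_polynomial :: "nat \<Rightarrow> (real ^ 'd \<Rightarrow> real) \<Rightarrow> bool" where
  "homogeneous_polynomial l V \<longleftrightarrow>
     (\<exists>c :: ('d \<Rightarrow> nat) \<Rightarrow> real.
        \<forall>x. V x = (\<Sum>k | (\<Sum>i\<in>UNIV. k i) = l. c k * (\<Prod>i\<in>UNIV. (x $ i) ^ k i)))"

definition partial_deriv :: "'d \<Rightarrow> (real ^ 'd \<Rightarrow> real) \<Rightarrow> real ^ 'd \<Rightarrow> real" where
  "partial_deriv i u x = deriv (\<lambda>t. u (x + t *\<^sub>R axis i 1)) 0"

definition laplacian :: "(real ^ 'd \<Rightarrow> real) \<Rightarrow> real ^ 'd \<Rightarrow> real" where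
  "laplacian u x = (\<Sum>i\<in>UNIV. partial_deriv i (partial_deriv i u) x)"

text \<open>As usual, the zero polynomial counts as homogeneous of every degree.\<close>

definition solid_harmonic :: "nat \<Rightarrow> (real ^ 'd \<Rightarrow> real) \<Rightarrow> bool" where
  "solid_harmonic l V \<longleftrightarrow> homogeneous_polynomial l V \<and> (\<forall>x. laplacian V x = 0)"

definition ball_weight :: "real \<Rightarrow> real ^ 'd \<Rightarrow> real" where
  "ball_weight \<gamma> x = (if norm x < 1 then (1 - (norm x)\<^sup>2) powr \<gamma> else 0)"

text \<open>Intended for \<open>b > -1\<close>; the parameter \<open>a\<close> is an arbitrary real number.\<close>

definition jacobi_poly :: "nat \<Rightarrow> real \<Rightarrow> real \<Rightarrow> real \<Rightarrow> real" where
  "jacobi_poly n a b t =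
     (- 1) ^ n * Gamma (b + 1 + real n) / fact n *
     (\<Sum>j\<le>n. pochhammer (- real n) j * pochhammer (1 + a + b + real n) j
            / (Gamma (b + 1 + real j) * fact j) * ((1 + t) / 2) ^ j)"

definition riesz_const :: "nat \<Rightarrow> real \<Rightarrow> real" where
  "riesz_const d \<beta> =
     2 powr \<beta> * pi powr (real d / 2) * Gamma (\<beta> / 2) / Gamma ((real d - \<beta>) / 2)"

definition riesz_integrand :: "real \<Rightarrow> (real ^ 'd \<Rightarrow> real) \<Rightarrow> real ^ 'd \<Rightarrow> real ^ 'd \<Rightarrow> real" where
  "riesz_integrand \<beta> u x y = u (x - y) / norm y powr (real CARD('d) - \<beta>)"

text \<open>The operator \<open>(-\<Delta>)\<^bsup>-\<beta>/2\<^esup>\<close> for \<open>0 < \<beta> < CARD('d)\<close>. The Bochner integral defaults to 0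
  for non-integrable functions, so the value is meaningful only where the integrand is
  integrable.\<close>

definition riesz_potential :: "real \<Rightarrow> (real ^ 'd \<Rightarrow> real) \<Rightarrow> real ^ 'd \<Rightarrow> real" where
  "riesz_potential \<beta> u x =
     1 / riesz_const CARD('d) \<beta> * (\<integral>y. riesz_integrand \<beta> u x y \<partial>lborel)"

end

theory Submission
  imports Defs "HOL-Probability.Distributions"
begin

text \<open>
  Write \<open>d\<close> for the dimension, \<open>\<beta> = 2 - \<alpha>\<close>, \<open>h = \<beta>/2\<close>, \<open>b = (d - \<beta>)/2\<close>, \<open>A = b + l\<close>, \<open>r = |x|\<^sup>2\<close>, and
  \<open>k = 1 - s\<close>, so that \<open>\<alpha>/2 - s = k - h\<close>.
  Gaussian averages reproduce harmonic polynomials. Expanding \<open>|x - y|\<^bsup>-2b\<^esup>\<close> into Gaussians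
  \<open>exp (-t|x - y|\<^sup>2)\<close> by the Gamma integral, completing the square and substituting \<open>u = t/(t + z)\<close>
  gives the integral of \<open>exp (-z|y|\<^sup>2) V(y)\<close> against this kernel as \<open>V(x)\<close> times the constant
  \<open>\<pi>\<^bsup>d/2\<^esup> / \<Gamma>(b)\<close> times \<open>z\<^bsup>-h\<^esup> \<integral> u\<^bsup>A-1\<^esup> (1 - u)\<^bsup>h-1\<^esup> exp (-r z u) du\<close>. Expanding \<open>z\<^bsup>-h\<^esup>\<close> as a Gamma integral as well,
  this is the instance \<open>g(\<rho>) = exp (-z \<rho>)\<close> of
  \<open>\<integral> g(|y|\<^sup>2) V(y) |x - y|\<^bsup>-2b\<^esup> dy = C V(x) \<integral>\<integral> u\<^bsup>A-1\<^esup> (1 - u)\<^bsup>h-1\<^esup> \<sigma>\<^bsup>h-1\<^esup> g(r u + \<sigma>) d\<sigma> du\<close>,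
  and the Weierstrass theorem in the variable \<open>exp (-\<rho>)\<close>, followed by a limit, extends this to
  \<open>g(\<rho>) = (1 - \<rho>)\<^bsup>\<gamma>\<^esup>\<close> on \<open>\<rho> < 1\<close>. There the \<open>\<sigma>\<close>-integral is a multiple of \<open>(1 - r u)\<^bsup>\<gamma>+h\<^esup>\<close>,
  which is a polynomial for \<open>\<gamma> = k + m - h\<close>. Expanding the Jacobi polynomial in powers of \<open>1 - |x|\<^sup>2\<close>
  reduces the theorem to the Chu-Vandermonde identity.
\<close>

subsection \<open>Jacobi polynomials\<close>

text \<open>Reflection turns the rising factorial of \<open>c + m\<close> of length
  \<open>n - m\<close> into \<open>(-1)^(n - m)\<close> times the one of \<open>1 - c - n\<close>,
  whose base no longer involves \<open>m\<close>. The binomial theorem for rising factorials then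
  applies, and a second reflection produces \<open>c - b\<close>. The identity serves twice: to
  re-expand the Jacobi polynomial and to sum the coefficients after integration.\<close>

lemma chu_vandermonde:
  fixes b c :: "'a :: comm_ring_1"
  shows "(\<Sum>m\<le>n. (-1) ^ m * of_nat (n choose m) * pochhammer b m * pochhammer (c + of_nat m) (n - m))
     = pochhammer (c - b) n"
proof -
  have "(-1) ^ m * of_nat (n choose m) * pochhammer b m * pochhammer (c + of_nat m) (n - m)
      = (-1) ^ n * (of_nat (n choose m) * pochhammer b m * pochhammer (1 - c - of_nat n) (n - m))"
    if "m \<le> n" for m
  proof -
    have "pochhammer (c + of_nat m) (n - m) = (-1) ^ (n - m) * pochhammer (1 - c - of_nat n) (n - m)"
      using pochhammer_minus[of "- (c + of_nat m)" "n - m"] that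
      by (simp add: of_nat_diff algebra_simps)
    moreover have "(-1 :: 'a) ^ n = (-1) ^ m * (-1) ^ (n - m)"
      using that by (simp flip: power_add)
    ultimately show ?thesis by (simp add: algebra_simps)
  qed
  then have "(\<Sum>m\<le>n. (-1) ^ m * of_nat (n choose m) * pochhammer b m * pochhammer (c + of_nat m) (n - m))
     = (-1) ^ n * pochhammer (b + (1 - c - of_nat n)) n"
    unfolding pochhammer_binomial_sum sum_distrib_left by (intro sum.cong) auto
  also have "\<dots> = pochhammer (c - b) n"
    using pochhammer_minus[of "b - c" n] by (simp add: algebra_simps)
  finally show ?thesis .
qed

lemma pochhammer_minus_of_nat:
  assumes "j \<le> n"
  shows "pochhammer (- real n) j = (-1) ^ j * fact n / fact (n - j)"
proof -
  have "pochhammer (real n - real j + 1) j = fact n / fact (n - j)"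
    using pochhammer_product[of "n - j" n "1::real"] assms
    by (simp add: of_nat_diff field_simps flip: pochhammer_fact)
  then show ?thesis by (simp add: pochhammer_minus)
qed

lemma Gamma_add_of_nat:
  fixes a :: real
  assumes "a > 0"
  shows "Gamma (a + real n) = pochhammer a n * Gamma a"
proof -
  have "a \<notin> \<int>\<^sub>\<le>\<^sub>0" using assms by (auto elim!: nonpos_Ints_cases)
  then have "pochhammer a n = Gamma (a + real n) / Gamma a" by (rule pochhammer_Gamma)
  then show ?thesis using Gamma_real_pos[OF assms] by simp
qed

lemma sum_triangle_swap:
  fixes F :: "nat \<Rightarrow> nat \<Rightarrow> 'a :: comm_monoid_add"
  shows "(\<Sum>j\<le>n. \<Sum>m\<le>j. F j m) = (\<Sum>m\<le>n. \<Sum>j=m..n. F j m)"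
proof (induction n)
  case (Suc n)
  have "(\<Sum>m\<le>n. \<Sum>j=m..Suc n. F j m) = (\<Sum>m\<le>n. (\<Sum>j=m..n. F j m) + F (Suc n) m)"
    by (intro sum.cong refl) simp
  then show ?case by (simp add: Suc sum.distrib add_ac)
qed simp

text \<open>Multiplying the weight by \<open>(1 - t)^m\<close> only raises its exponent by
  \<open>m\<close>, so this expansion is suited to termwise integration. It arises from
  \<open>t^j = (1 - (1 - t))^j\<close> by swapping the sums. The inner sum is Chu-Vandermonde with
  parameters \<open>E + m\<close> and \<open>b + 1 + m\<close>; their difference
  \<open>- a - n\<close> reflects to \<open>a + m + 1\<close>.\<close>

lemma jacobi_poly_one_minus_basis:
  assumes "b > -1"
  shows "jacobi_poly n a b (2 * t - 1) =
    (\<Sum>m\<le>n. (-1) ^ m / fact n * real (n choose m) * pochhammer (1 + a + b + real n) m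
        * pochhammer (a + real m + 1) (n - m) * (1 - t) ^ m)"
proof -
  define E where "E = 1 + a + b + real n"
  \<comment> \<open>The coefficient of \<open>t^j\<close> up to the factor
    \<open>(-1)^n / fact n\<close>: the quotient of Gamma values has become a rising factorial, and
    that of \<open>- n\<close> divided by \<open>fact j\<close> a signed binomial
    coefficient.\<close>
  define a' where "a' j = (-1) ^ j * real (n choose j) * pochhammer E j * pochhammer (b + 1 + real j) (n - j)" for j
  have "jacobi_poly n a b (2 * t - 1) = (-1) ^ n / fact n * (\<Sum>j\<le>n. a' j * t ^ j)"
    unfolding jacobi_poly_def sum_distrib_left
  proof (intro sum.cong refl)
    fix j assume "j \<in> {..n}"
    then have j: "j \<le> n" by simp
    have G: "Gamma (b + 1 + real n) = pochhammer (b + 1 + real j) (n - j) * Gamma (b + 1 + real j)"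
      using Gamma_add_of_nat[of "b + 1 + real j" "n - j"] assms j by (simp add: of_nat_diff add_ac)
    have pos: "Gamma (b + 1 + real j) > 0" using assms by (intro Gamma_real_pos) auto
    have c: "real (n choose j) = fact n / (fact j * fact (n - j))" using j by (rule binomial_fact)
    show "(- 1) ^ n * Gamma (b + 1 + real n) / fact n *
         (pochhammer (- real n) j * pochhammer (1 + a + b + real n) j / (Gamma (b + 1 + real j) * fact j) *
          ((1 + (2 * t - 1)) / 2) ^ j) = (- 1) ^ n / fact n * (a' j * t ^ j)"
      unfolding a'_def E_def pochhammer_minus_of_nat[OF j] G c using pos by (simp add: field_simps)
  qed
  also have "(\<Sum>j\<le>n. a' j * t ^ j) = (\<Sum>j\<le>n. \<Sum>m\<le>j. a' j * real (j choose m) * (-1) ^ m * (1 - t) ^ m)"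
  proof (intro sum.cong refl)
    fix j
    have "t ^ j = (- (1 - t) + 1) ^ j" by simp
    also have "\<dots> = (\<Sum>m\<le>j. real (j choose m) * (- (1 - t)) ^ m)"
      by (subst binomial_ring) simp
    also have "\<dots> = (\<Sum>m\<le>j. real (j choose m) * ((-1) ^ m * (1 - t) ^ m))"
      by (intro sum.cong refl) (subst power_minus, rule refl)
    finally show "a' j * t ^ j = (\<Sum>m\<le>j. a' j * real (j choose m) * (-1) ^ m * (1 - t) ^ m)"
      by (simp add: sum_distrib_left mult_ac)
  qed
  also have "\<dots> = (\<Sum>m\<le>n. \<Sum>j=m..n. a' j * real (j choose m) * (-1) ^ m * (1 - t) ^ m)"
    by (rule sum_triangle_swap)
  also have "\<dots> = (\<Sum>m\<le>n. (-1) ^ (n - m) * real (n choose m) * pochhammer E m * pochhammer (a + real m + 1) (n - m) * (1 - t) ^ m)"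
  proof (intro sum.cong refl)
    fix m assume "m \<in> {..n}"
    then have m: "m \<le> n" by simp
    have "(\<Sum>j=m..n. a' j * real (j choose m)) = (\<Sum>p\<le>n-m. a' (p + m) * real ((p + m) choose m))"
      by (rule sum.reindex_bij_witness[of _ "\<lambda>p. p + m" "\<lambda>j. j - m"]) (use m in auto)
    also have "\<dots> = (-1) ^ m * real (n choose m) * pochhammer E m *
       (\<Sum>p\<le>n-m. (-1) ^ p * real ((n - m) choose p) * pochhammer (E + m) p * pochhammer ((b + 1 + m) + real p) (n - m - p))"
      unfolding sum_distrib_left
    proof (intro sum.cong refl)
      fix p assume "p \<in> {..n - m}"
      then have p: "p \<le> n - m" by simp
      \<comment> \<open>This rearrangement of binomial coefficients pulls out all that depends on
        \<open>m\<close> alone and leaves an alternating sum of length \<open>n - m\<close>.\<close>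
      have "(n choose (p + m)) * ((p + m) choose m) = (n choose m) * ((n - m) choose p)"
        using choose_mult[of m "p + m" n] p m by simp
      then have "real (n choose (p + m)) * real ((p + m) choose m) = real (n choose m) * real ((n - m) choose p)"
        by (metis of_nat_mult)
      moreover have "pochhammer E (p + m) = pochhammer E m * pochhammer (E + m) p"
        using pochhammer_product[of m "p + m" E] by simp
      ultimately show "a' (p + m) * real ((p + m) choose m) = (-1) ^ m * real (n choose m) * pochhammer E m *
        ((-1) ^ p * real ((n - m) choose p) * pochhammer (E + m) p * pochhammer ((b + 1 + m) + real p) (n - m - p))"
        unfolding a'_def by (simp add: power_add algebra_simps)
    qed
    also have "\<dots> = (-1) ^ m * real (n choose m) * pochhammer E m * pochhammer (b + 1 + m - (E + m)) (n - m)"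
      by (subst chu_vandermonde) simp
    also have "pochhammer (b + 1 + m - (E + m)) (n - m) = (-1) ^ (n - m) * pochhammer (a + m + 1) (n - m)"
      using pochhammer_minus[of "a + real n" "n - m"] m by (simp add: E_def of_nat_diff algebra_simps)
    finally have *: "(\<Sum>j=m..n. a' j * real (j choose m)) =
       (-1) ^ m * real (n choose m) * pochhammer E m * ((-1) ^ (n - m) * pochhammer (a + m + 1) (n - m))" .
    have "(\<Sum>j=m..n. a' j * real (j choose m) * (-1) ^ m * (1 - t) ^ m)
      = (\<Sum>j=m..n. a' j * real (j choose m)) * ((-1) ^ m * (1 - t) ^ m)"
      by (simp add: sum_distrib_left mult_ac)
    also have "\<dots> = ((-1) ^ m * (-1) ^ m) * ((-1) ^ (n - m) * real (n choose m) * pochhammer E m * pochhammer (a + real m + 1) (n - m) * (1 - t) ^ m)"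
      unfolding * by (simp add: algebra_simps)
    finally show "(\<Sum>j=m..n. a' j * real (j choose m) * (-1) ^ m * (1 - t) ^ m) =
     (-1) ^ (n - m) * real (n choose m) * pochhammer E m * pochhammer (a + real m + 1) (n - m) * (1 - t) ^ m"
      by (simp flip: power_add)
  qed
  also have "(-1) ^ n / fact n * \<dots> = (\<Sum>m\<le>n. (-1) ^ m / fact n * real (n choose m) * pochhammer E m
        * pochhammer (a + real m + 1) (n - m) * (1 - t) ^ m)"
    unfolding sum_distrib_left
  proof (intro sum.cong refl)
    fix m assume "m \<in> {..n}"
    then have "(-1 :: real) ^ n * (-1) ^ (n - m) = (-1) ^ m"
      by (simp add: minus_one_power_iff)
    then show "(-1) ^ n / fact n * ((-1) ^ (n - m) * real (n choose m) * pochhammer E m * pochhammer (a + real m + 1) (n - m) * (1 - t) ^ m)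
     = (-1) ^ m / fact n * real (n choose m) * pochhammer E m * pochhammer (a + real m + 1) (n - m) * (1 - t) ^ m"
      by (metis (no_types, lifting) mult.assoc times_divide_eq_left)
  qed
  finally show ?thesis by (simp add: E_def)
qed

text \<open>The left side is \<open>1 / (fact i * fact (k + m - i))\<close>, and the rising
  factorial supplies the factors from \<open>k + m - i + 1\<close> to \<open>n + k - i\<close>. For
  \<open>i > k + m\<close> both sides vanish, since the rising factorial then runs through zero.
  This puts the dependence on \<open>m\<close> into the shape that \<open>chu_vandermonde\<close>
  expects, over a range of \<open>i\<close> independent of \<open>m\<close>.\<close>

lemma binomial_div_fact_eq_pochhammer:
  assumes "m \<le> n" "i \<le> n + k"
  shows "real ((k + m) choose i) / fact (k + m) =
    pochhammer ((real k - real i + 1) + real m) (n - m) / (fact i * fact (n + k - i))"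
proof (cases "i \<le> k + m")
  case True
  have "(fact (n + k - i) :: real) = pochhammer ((real k - real i + 1) + real m) (n - m) * fact (k + m - i)"
    using pochhammer_product[of "k + m - i" "n + k - i" "1::real"] True assms
    by (simp add: pochhammer_fact of_nat_diff algebra_simps)
  moreover have "pochhammer ((real k - real i + 1) + real m) (n - m) \<noteq> 0"
    using calculation by (metis fact_nonzero mult_zero_left)
  ultimately show ?thesis using True by (simp add: binomial_fact)
next
  case False
  have "pochhammer (- real (i - k - m - 1)) (n - m) = 0"
    using False assms by (subst pochhammer_of_nat_eq_0_iff) auto
  moreover have "(real k - real i + 1) + real m = - real (i - k - m - 1)"
    using False by (simp add: of_nat_diff)
  ultimately show ?thesis using False by (metis binomial_eq_0 div_0 not_le of_nat_0)
qed

text \<open>The first factor is the coefficient of the Jacobi polynomial in powers of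
  \<open>1 - t\<close>, the second what integration makes of such a power. For fixed
  \<open>i\<close> the sum over \<open>m\<close> is a Chu-Vandermonde sum; it gives a rising
  factorial of \<open>A + i\<close>, which lifts \<open>Gamma (A + i)\<close> to
  \<open>Gamma (A + n + i)\<close>. These are the coefficients of the Jacobi polynomial of degree
  \<open>n + k\<close>.\<close>

lemma jacobi_coefficient_sum:
  fixes A N h r :: real and n k :: nat
  assumes "A > 0" "h > 0" "N = A + h" "real k - h > -1"
  shows "(\<Sum>m\<le>n. ((-1) ^ m / fact n * real (n choose m) * pochhammer (real k - h + N + real n) m
            * pochhammer (real k - h + real m + 1) (n - m))
          * (Gamma (real k - h + real m + 1) / fact (k + m)
             * (\<Sum>i\<le>k + m. real ((k + m) choose i) * (- r) ^ i * Gamma (A + real i) / Gamma (N + real i))))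
     = (-1) ^ k * Gamma (real n + real k + 1 - h) * Gamma (real n + A) / (fact n * Gamma (real n + real k + N))
        * jacobi_poly (n + k) (- real k - h) (N - 1) (2 * r - 1)" (is "?L = ?R")
proof -
  define E where "E = real k - h + N + real n"
  define G where "G = Gamma (real n + real k + 1 - h)"
  define P where "P m i = pochhammer ((real k - real i + 1) + real m) (n - m)" for m i
  define q where "q i = (- r) ^ i * Gamma (A + real i) / Gamma (N + real i) / (fact i * fact (n + k - i))" for i
  have "?L = (\<Sum>m\<le>n. G / fact n * (\<Sum>i\<le>n+k. ((-1) ^ m * real (n choose m) * pochhammer E m * P m i) * q i))"
  proof (intro sum.cong refl)
    fix m assume "m \<in> {..n}"
    then have m: "m \<le> n" by simp
    \<comment> \<open>The added terms have \<open>i > k + m\<close> and a zero binomial coefficient;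
      a common range lets the sums over \<open>m\<close> and \<open>i\<close> be exchanged.\<close>
    have "(\<Sum>i\<le>k + m. real ((k + m) choose i) * (- r) ^ i * Gamma (A + real i) / Gamma (N + real i))
      = (\<Sum>i\<le>n + k. real ((k + m) choose i) * (- r) ^ i * Gamma (A + real i) / Gamma (N + real i))"
      by (intro sum.mono_neutral_left) (use m in \<open>auto simp: binomial_eq_0\<close>)
    also have "\<dots> = fact (k + m) * (\<Sum>i\<le>n + k. P m i * q i)"
      unfolding sum_distrib_left
    proof (intro sum.cong refl)
      fix i assume "i \<in> {..n + k}"
      then have "real ((k + m) choose i) = fact (k + m) * (P m i / (fact i * fact (n + k - i)))"
        using binomial_div_fact_eq_pochhammer[OF m, of i k] by (simp add: P_def field_simps)
      then show "real ((k + m) choose i) * (- r) ^ i * Gamma (A + real i) / Gamma (N + real i) = fact (k + m) * (P m i * q i)"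
        by (simp add: q_def mult_ac)
    qed
    finally have 1: "Gamma (real k - h + real m + 1) / fact (k + m)
             * (\<Sum>i\<le>k + m. real ((k + m) choose i) * (- r) ^ i * Gamma (A + real i) / Gamma (N + real i))
       = Gamma (real k - h + real m + 1) * (\<Sum>i\<le>n + k. P m i * q i)" by simp
    \<comment> \<open>The rising factorial from the Jacobi coefficient completes the Gamma factor to
      \<open>G\<close>, which is free of \<open>m\<close>.\<close>
    have 2: "G = pochhammer (real k - h + real m + 1) (n - m) * Gamma (real k - h + real m + 1)"
      using Gamma_add_of_nat[of "real k - h + real m + 1" "n - m"] assms m by (simp add: G_def of_nat_diff algebra_simps)
    show "((-1) ^ m / fact n * real (n choose m) * pochhammer (real k - h + N + real n) m
            * pochhammer (real k - h + real m + 1) (n - m))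
          * (Gamma (real k - h + real m + 1) / fact (k + m)
             * (\<Sum>i\<le>k + m. real ((k + m) choose i) * (- r) ^ i * Gamma (A + real i) / Gamma (N + real i)))
      = G / fact n * (\<Sum>i\<le>n+k. ((-1) ^ m * real (n choose m) * pochhammer E m * P m i) * q i)"
      unfolding 1 2 by (simp add: E_def sum_distrib_left sum_divide_distrib mult_ac)
  qed
  also have "\<dots> = G / fact n * (\<Sum>i\<le>n+k. (\<Sum>m\<le>n. (-1) ^ m * real (n choose m) * pochhammer E m * P m i) * q i)"
    unfolding sum_distrib_left[symmetric] sum_distrib_right by (subst sum.swap) simp
  also have "\<dots> = G / fact n * (\<Sum>i\<le>n+k. pochhammer (real k - real i + 1 - E) n * q i)"
    unfolding P_def by (subst chu_vandermonde) simp
  also have "\<dots> = (-1) ^ n * G / fact n * (\<Sum>i\<le>n+k. (- r) ^ i * Gamma (A + real n + real i) / Gamma (N + real i) / (fact i * fact (n + k - i)))"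
  proof -
    have "pochhammer (real k - real i + 1 - E) n * q i = (-1) ^ n * ((- r) ^ i * Gamma (A + real n + real i) / Gamma (N + real i) / (fact i * fact (n + k - i)))" for i
    proof -
      \<comment> \<open>By \<open>N = A + h\<close> the base \<open>k - i + 1 - E\<close> equals
        \<open>-(A + i + n - 1)\<close>, which reflects to \<open>A + i\<close>.\<close>
      have "pochhammer (real k - real i + 1 - E) n = (-1) ^ n * pochhammer (A + real i) n"
        using pochhammer_minus[of "A + real i + real n - 1" n] assms(3) by (simp add: E_def algebra_simps)
      moreover have "Gamma (A + real n + real i) = pochhammer (A + real i) n * Gamma (A + real i)"
        using Gamma_add_of_nat[of "A + real i" n] assms by (simp add: algebra_simps)
      ultimately show ?thesis by (simp add: q_def)
    qed
    then show ?thesis by (simp add: sum_distrib_left mult_ac)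
  qed
  also have "\<dots> = ?R"
  proof -
    have g1: "Gamma (real n + real k + N) > 0" using assms by (intro Gamma_real_pos) auto
    have g2: "Gamma (real n + A) > 0" using assms by (intro Gamma_real_pos) auto
    then have g2': "Gamma (A + real n) \<noteq> 0" by (simp add: add.commute)
    have *: "pochhammer (- real (n + k)) i * pochhammer (1 + (- real k - h) + (N - 1) + real (n + k)) i
            / (Gamma (N - 1 + 1 + real i) * fact i) * ((1 + (2 * r - 1)) / 2) ^ i
      = fact (n + k) / Gamma (real n + A) * ((- r) ^ i * Gamma (A + real n + real i) / Gamma (N + real i) / (fact i * fact (n + k - i)))"
      if i: "i \<le> n + k" for i
    proof -
      have a: "pochhammer (1 + (- real k - h) + (N - 1) + real (n + k)) i = Gamma (A + real n + real i) / Gamma (real n + A)"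
        using Gamma_add_of_nat[of "A + real n" i] g2' assms(1)
        by (simp add: assms(3) eq_divide_eq add_ac mult_ac)
      have b: "(- r) ^ i = (-1) ^ i * r ^ i" by (rule power_minus)
      show ?thesis unfolding a b pochhammer_minus_of_nat[OF i] by (simp add: mult_ac)
    qed
    have S: "(\<Sum>i\<le>n+k. pochhammer (- real (n + k)) i * pochhammer (1 + (- real k - h) + (N - 1) + real (n + k)) i
            / (Gamma (N - 1 + 1 + real i) * fact i) * ((1 + (2 * r - 1)) / 2) ^ i)
      = fact (n + k) / Gamma (real n + A) *
        (\<Sum>i\<le>n+k. (- r) ^ i * Gamma (A + real n + real i) / Gamma (N + real i) / (fact i * fact (n + k - i)))"
      unfolding sum_distrib_left by (intro sum.cong refl *) auto
    have "N - 1 + 1 + real (n + k) = real n + real k + N" by simp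
    note jacobi_poly_def[of "n + k" "- real k - h" "N - 1" "2 * r - 1", unfolded S this]
    then show ?thesis using g1 g2 by (simp add: G_def power_add field_simps)
  qed
  finally show ?thesis .
qed

subsection \<open>Gaussian averages of harmonic polynomials\<close>

text \<open>Lebesgue measure on vectors is the image of the product measure indexed by basis
  vectors. The proof transports the index along the bijection from coordinates \<open>i\<close> to
  \<open>axis i 1\<close> and then applies Fubini for finite products.\<close>

lemma has_bochner_integral_lborel_prod_vec:
  fixes f :: "'d::finite \<Rightarrow> real \<Rightarrow> real"
  assumes "\<And>i. has_bochner_integral lborel (f i) (I i)"
  shows "has_bochner_integral lborel (\<lambda>y :: real ^ 'd. \<Prod>i\<in>UNIV. f i (y $ i)) (\<Prod>i\<in>UNIV. I i)"
proof -
  let ?ax = "\<lambda>i :: 'd. axis i 1 :: real ^ 'd"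
  interpret product_sigma_finite "\<lambda>_ :: real ^ 'd. lborel :: real measure" ..
  have inj: "inj ?ax" by (simp add: inj_def axis_eq_axis)
  have Bas: "Basis = range ?ax" by (auto simp: Basis_vec_def)
  define g where "g b = f (inv ?ax b)" for b
  have [measurable]: "f i \<in> borel_measurable borel" for i
    using borel_measurable_has_bochner_integral[OF assms] by simp
  have intf: "integrable lborel (f i)" "integral\<^sup>L lborel (f i) = I i" for i
    using assms[of i] by (auto simp: has_bochner_integral_iff)
  have comp: "(\<Sum>b\<in>Basis. x b *\<^sub>R b) $ i = x (?ax i)" for x :: "real ^ 'd \<Rightarrow> real" and i
    unfolding Bas sum.reindex[OF inj] by (simp add: axis_def if_distrib cong: if_cong)
  have prod: "(\<Prod>i\<in>UNIV. f i ((\<Sum>b\<in>Basis. x b *\<^sub>R b) $ i)) = (\<Prod>b\<in>Basis. g b (x b))" for x :: "real ^ 'd \<Rightarrow> real"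
    unfolding comp unfolding Bas by (simp add: prod.reindex[OF inj] g_def inv_f_f[OF inj])
  have prodI: "(\<Prod>b\<in>Basis. integral\<^sup>L lborel (g b)) = (\<Prod>i\<in>UNIV. I i)"
    unfolding Bas by (simp add: prod.reindex[OF inj] g_def inv_f_f[OF inj] intf)
  have "integrable (\<Pi>\<^sub>M b\<in>Basis. lborel) (\<lambda>x. \<Prod>b\<in>Basis. g b (x b))"
    by (intro product_integrable_prod) (auto simp: g_def intf)
  moreover have "(\<integral>x. (\<Prod>b\<in>Basis. g b (x b)) \<partial>(\<Pi>\<^sub>M b\<in>Basis. lborel)) = (\<Prod>i\<in>UNIV. I i)"
    unfolding prodI[symmetric] by (intro product_integral_prod) (auto simp: g_def intf)
  ultimately show ?thesis
    unfolding has_bochner_integral_iff lborel_eq[where 'a = "real ^ 'd"]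
    by (simp add: integrable_distr_eq integral_distr prod del: sum_component vector_scaleR_component)
qed

section \<open>Moments of one-dimensional normal distributions\<close>

definition std_moment :: "nat \<Rightarrow> real" where
  "std_moment j = (if even j then fact j / (2 ^ (j div 2) * fact (j div 2)) else 0)"

lemma std_moment_simps [simp]:
  "std_moment 0 = 1" "std_moment (Suc 0) = 0"
  "std_moment (Suc (Suc j)) = (real j + 1) * std_moment j"
proof -
  show "std_moment (Suc (Suc j)) = (real j + 1) * std_moment j"
  proof (cases "even j")
    case True
    then obtain b where b: "j = 2 * b" by (elim evenE)
    have "std_moment (Suc (Suc j)) = (2 * real (Suc b) * (real j + 1) * fact j) / (2 * real (Suc b) * (2 ^ b * fact b))"
      by (simp add: b std_moment_def algebra_simps)
    then show ?thesis by (simp add: b std_moment_def del: of_nat_Suc)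
  qed (simp add: std_moment_def)
qed (simp_all add: std_moment_def)

text \<open>The \<open>k\<close>-th moment of the normal distribution with mean \<open>c\<close> and
  deviation \<sigma>. As a polynomial it also has a value at deviation 0, where the distribution
  degenerates to the point \<open>c\<close>.\<close>

definition normal_poly :: "nat \<Rightarrow> real \<Rightarrow> real \<Rightarrow> real" where
  "normal_poly k c \<sigma> = (\<Sum>j\<le>k. real (k choose j) * c ^ (k - j) * \<sigma> ^ j * std_moment j)"

lemma has_bochner_integral_normal_poly:
  assumes "\<sigma> > 0"
  shows "has_bochner_integral lborel (\<lambda>y. normal_density c \<sigma> y * y ^ k) (normal_poly k c \<sigma>)"
proof -
  have central: "has_bochner_integral lborel (\<lambda>y. normal_density c \<sigma> y * (y - c) ^ j) (\<sigma> ^ j * std_moment j)" for j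
  proof (cases "even j")
    case True
    then obtain i where i: "j = 2 * i" by (elim evenE)
    show ?thesis
      using normal_moment_even[OF assms, of c i] assms
      by (simp add: i std_moment_def power_divide field_simps flip: power_mult)
  next
    case False
    then obtain i where i: "j = 2 * i + 1" by (elim oddE)
    show ?thesis using normal_moment_odd[OF assms, of c i] by (simp add: i std_moment_def)
  qed
  have "normal_density c \<sigma> y * y ^ k = (\<Sum>j\<le>k. real (k choose j) * c ^ (k - j) * (normal_density c \<sigma> y * (y - c) ^ j))" for y
    using binomial_ring[of "y - c" c k] by (simp add: sum_distrib_left mult_ac)
  moreover have "has_bochner_integral lborel
      (\<lambda>y. \<Sum>j\<le>k. real (k choose j) * c ^ (k - j) * (normal_density c \<sigma> y * (y - c) ^ j))
      (\<Sum>j\<le>k. real (k choose j) * c ^ (k - j) * (\<sigma> ^ j * std_moment j))"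
    by (intro has_bochner_integral_sum has_bochner_integral_mult_right central)
  ultimately show ?thesis by (simp add: normal_poly_def mult_ac)
qed

lemma normal_poly_0 [simp]: "normal_poly k c 0 = c ^ k"
proof -
  have "normal_poly k c 0 = (\<Sum>j\<le>k. if j = 0 then c ^ k else 0)"
    unfolding normal_poly_def by (intro sum.cong) (auto simp: power_0_left)
  then show ?thesis by simp
qed

text \<open>This is the heat equation: the factor after \<sigma> is the second derivative of the
  moment in \<open>c\<close>. Termwise it is the recursion of \<open>std_moment\<close> together
  with absorption of binomial coefficients. For \<open>k < 2\<close> the product
  \<open>k * (k - 1)\<close> is zero, so the truncated \<open>k - 2\<close> does no harm.\<close>

lemma DERIV_normal_poly:
  "((\<lambda>\<sigma>. normal_poly k c \<sigma>) has_real_derivative \<sigma> * (real k * real (k - 1) * normal_poly (k - 2) c \<sigma>)) (at \<sigma>)"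
proof (cases "k < 2")
  case True
  then have "k = 0 \<or> k = 1" by auto
  then show ?thesis by (auto simp: normal_poly_def)
next
  case False
  then obtain q where k: "k = Suc (Suc q)" by (metis add_2_eq_Suc le_Suc_ex not_less)
  have "((\<lambda>\<sigma>. normal_poly k c \<sigma>) has_real_derivative
      (\<Sum>j\<le>k. real (k choose j) * c ^ (k - j) * (real j * \<sigma> ^ (j - 1)) * std_moment j)) (at \<sigma>)"
    unfolding normal_poly_def by (auto intro!: derivative_eq_intros simp: mult_ac)
  also have "(\<Sum>j\<le>k. real (k choose j) * c ^ (k - j) * (real j * \<sigma> ^ (j - 1)) * std_moment j)
     = (\<Sum>j\<le>q. real (k choose (Suc (Suc j))) * c ^ (q - j) * (real (j + 2) * \<sigma> ^ (j + 1)) * ((real j + 1) * std_moment j))"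
    unfolding k by (subst sum.atMost_Suc_shift, subst sum.atMost_Suc_shift) simp
  also have "\<dots> = \<sigma> * (real k * real (k - 1) * normal_poly (k - 2) c \<sigma>)"
    unfolding normal_poly_def sum_distrib_left
  proof (intro sum.cong)
    fix j
    have "Suc (Suc j) * (Suc j * (Suc (Suc q) choose Suc (Suc j))) = Suc (Suc q) * (Suc q * (q choose j))"
      using Suc_times_binomial[of "Suc j" "Suc q"] Suc_times_binomial[of j q]
      by (metis mult.left_commute)
    then have "real (Suc (Suc j)) * (real (Suc j) * real (Suc (Suc q) choose Suc (Suc j))) = real (Suc (Suc q)) * (real (Suc q) * real (q choose j))"
      by (metis of_nat_mult)
    then have "(real j + 2) * (real j + 1) * real (k choose (Suc (Suc j))) = real k * real (k - 1) * real (q choose j)"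
      by (simp add: k algebra_simps)
    then show "real (k choose (Suc (Suc j))) * c ^ (q - j) * (real (j + 2) * \<sigma> ^ (j + 1)) * ((real j + 1) * std_moment j)
      = \<sigma> * (real k * real (k - 1) * (real (k - 2 choose j) * c ^ (k - 2 - j) * \<sigma> ^ j * std_moment j))"
      by (simp add: k) algebra
  qed (simp add: k)
  finally show ?thesis .
qed

section \<open>The Laplacian of monomials and the Gaussian mean value property\<close>

definition monomial :: "('d::finite \<Rightarrow> nat) \<Rightarrow> real ^ 'd \<Rightarrow> real" where
  "monomial k x = (\<Prod>i\<in>UNIV. (x $ i) ^ k i)"

lemma prod_fun_upd_split:
  "(\<Prod>j\<in>UNIV. g j ((k(i := v)) j)) = g i v * (\<Prod>j\<in>UNIV - {i::'d::finite}. (g j (k j) :: real))"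
  by (simp add: prod.remove[of UNIV i])

text \<open>The exponents are a function \<open>e\<close> of the summation index so that the rule
  applies again to its own result, whose exponents are no longer the index. Truncated subtraction is
  harmless because the coefficient \<open>e k i\<close> vanishes with the exponent.\<close>

lemma partial_deriv_monomial_sum:
  fixes e :: "'a \<Rightarrow> 'd::finite \<Rightarrow> nat"
  shows
  "partial_deriv i (\<lambda>x. \<Sum>k\<in>K. c k * monomial (e k) x)
    = (\<lambda>x. \<Sum>k\<in>K. c k * real (e k i) * monomial ((e k)(i := e k i - 1)) x)"
proof
  fix x :: "real ^ 'd"
  have split: "monomial (e k) (x + t *\<^sub>R axis i 1) = (x $ i + t) ^ e k i * (\<Prod>j\<in>UNIV - {i}. (x $ j) ^ e k j)" for k t
    unfolding monomial_def by (subst prod.remove[of UNIV i]) (auto simp: axis_def intro!: prod.cong)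
  have "((\<lambda>t. \<Sum>k\<in>K. c k * monomial (e k) (x + t *\<^sub>R axis i 1)) has_real_derivative
      (\<Sum>k\<in>K. c k * (real (e k i) * (x $ i) ^ (e k i - 1) * (\<Prod>j\<in>UNIV - {i}. (x $ j) ^ e k j)))) (at 0)"
    unfolding split by (auto intro!: derivative_eq_intros sum.cong)
  moreover have "monomial ((e k)(i := v)) x = (x $ i) ^ v * (\<Prod>j\<in>UNIV - {i}. (x $ j) ^ e k j)" for k v
    unfolding monomial_def by (rule prod_fun_upd_split)
  ultimately show "partial_deriv i (\<lambda>x. \<Sum>k\<in>K. c k * monomial (e k) x) x
    = (\<Sum>k\<in>K. c k * real (e k i) * monomial ((e k)(i := e k i - 1)) x)"
    unfolding partial_deriv_def
    by (simp add: DERIV_imp_deriv mult_ac)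
qed

lemma laplacian_monomial_sum:
  "laplacian (\<lambda>x. \<Sum>k\<in>K. c k * monomial k x) x
    = (\<Sum>i\<in>UNIV. \<Sum>k\<in>K. c k * (real (k i) * real (k i - 1)) * monomial (k(i := k i - 2)) x)"
proof -
  have 1: "partial_deriv i (\<lambda>x. \<Sum>k\<in>K. c k * monomial k x)
    = (\<lambda>x. \<Sum>k\<in>K. c k * real (k i) * monomial (k(i := k i - 1)) x)" for i
    using partial_deriv_monomial_sum[where e = "\<lambda>k. k"] .
  have 2: "partial_deriv i (\<lambda>x. \<Sum>k\<in>K. c k * real (k i) * monomial (k(i := k i - 1)) x) x
    = (\<Sum>k\<in>K. c k * (real (k i) * real (k i - 1)) * monomial (k(i := k i - 2)) x)" for i
    unfolding partial_deriv_monomial_sum by (simp add: numeral_2_eq_2 mult_ac)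
  show ?thesis unfolding laplacian_def 1 2 ..
qed

definition gauss_density :: "real ^ 'd::finite \<Rightarrow> real \<Rightarrow> real ^ 'd \<Rightarrow> real" where
  "gauss_density c \<sigma> y = (\<Prod>i\<in>UNIV. normal_density (c $ i) \<sigma> (y $ i))"

lemma gauss_density_eq:
  "gauss_density (c :: real ^ 'd::finite) \<sigma> y = (1 / sqrt (2 * pi * \<sigma>\<^sup>2)) ^ CARD('d) * exp (- (norm (y - c))\<^sup>2 / (2 * \<sigma>\<^sup>2))"
proof -
  have "gauss_density c \<sigma> y = (1 / sqrt (2 * pi * \<sigma>\<^sup>2)) ^ CARD('d) * exp (\<Sum>i\<in>UNIV. - (y $ i - c $ i)\<^sup>2 / (2 * \<sigma>\<^sup>2))"
    unfolding gauss_density_def normal_density_def by (subst prod.distrib) (simp add: exp_sum)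
  also have "(\<Sum>i\<in>UNIV. - (y $ i - c $ i)\<^sup>2 / (2 * \<sigma>\<^sup>2)) = - (norm (y - c))\<^sup>2 / (2 * \<sigma>\<^sup>2)"
    unfolding power2_norm_eq_inner inner_vec_def
    by (simp add: sum_negf power2_eq_square flip: sum_divide_distrib)
  finally show ?thesis .
qed

lemma has_bochner_integral_gauss_monomial:
  assumes "\<sigma> > 0"
  shows "has_bochner_integral lborel (\<lambda>y. gauss_density c \<sigma> y * monomial k y) (\<Prod>i\<in>UNIV. normal_poly (k i) (c $ i) \<sigma>)"
  using has_bochner_integral_lborel_prod_vec[OF has_bochner_integral_normal_poly[OF assms], of "\<lambda>i. c $ i" k]
  by (simp add: gauss_density_def monomial_def prod.distrib)

lemma solid_harmonic_monomial_sum: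
  assumes "solid_harmonic l V"
  obtains c where "V = (\<lambda>x. \<Sum>k | (\<Sum>i\<in>UNIV. k i) = l. c k * monomial k x)"
  using assms unfolding solid_harmonic_def homogeneous_polynomial_def monomial_def by blast

text \<open>The Gaussian average \<open>W s\<close> satisfies the heat equation, so its derivative
  is \<open>s\<close> times the Gaussian average of the Laplacian of \<open>V\<close>, which is
  zero. Hence \<open>W\<close> is constant, and at deviation 0 it is the point value
  \<open>V x\<close>.\<close>

lemma gauss_mean_value_solid_harmonic:
  fixes V :: "real ^ 'd \<Rightarrow> real"
  assumes V: "solid_harmonic l V" and "\<sigma> > 0"
  shows "has_bochner_integral lborel (\<lambda>y. gauss_density x \<sigma> y * V y) (V x)"
proof -
  obtain c where c: "V = (\<lambda>x. \<Sum>k | (\<Sum>i\<in>UNIV. k i) = l. c k * monomial k x)"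
    using solid_harmonic_monomial_sum[OF V] .
  define K where "K = {k :: 'd \<Rightarrow> nat. (\<Sum>i\<in>UNIV. k i) = l}"
  note c = c[folded K_def]
  define W where "W s = (\<Sum>k\<in>K. c k * (\<Prod>i\<in>UNIV. normal_poly (k i) (x $ i) s))" for s
  have W: "has_bochner_integral lborel (\<lambda>y. gauss_density x s y * V y) (W s)" if "s > 0" for s
  proof -
    have "has_bochner_integral lborel (\<lambda>y. \<Sum>k\<in>K. c k * (gauss_density x s y * monomial k y)) (W s)"
      unfolding W_def by (intro has_bochner_integral_sum has_bochner_integral_mult_right
        has_bochner_integral_gauss_monomial that)
    then show ?thesis by (simp add: c sum_distrib_left mult_ac)
  qed
  \<comment> \<open>The left side is the Gaussian average of \<open>laplacian V\<close>, evaluated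
    monomial by monomial; the integrand vanishes identically.\<close>
  have zero: "(\<Sum>i\<in>UNIV. \<Sum>k\<in>K. c k * (real (k i) * real (k i - 1)) *
      (\<Prod>j\<in>UNIV. normal_poly ((k(i := k i - 2)) j) (x $ j) s)) = 0" if "s > 0" for s
  proof -
    have "has_bochner_integral lborel (\<lambda>y. \<Sum>i\<in>UNIV. \<Sum>k\<in>K. c k * (real (k i) * real (k i - 1)) *
       (gauss_density x s y * monomial (k(i := k i - 2)) y))
      (\<Sum>i\<in>UNIV. \<Sum>k\<in>K. c k * (real (k i) * real (k i - 1)) *
      (\<Prod>j\<in>UNIV. normal_poly ((k(i := k i - 2)) j) (x $ j) s))"
      by (intro has_bochner_integral_sum has_bochner_integral_mult_right
        has_bochner_integral_gauss_monomial that)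
    moreover have "(\<Sum>i\<in>UNIV. \<Sum>k\<in>K. c k * (real (k i) * real (k i - 1)) *
       (gauss_density x s y * monomial (k(i := k i - 2)) y)) = 0" for y
    proof -
      have "(\<Sum>i\<in>UNIV. \<Sum>k\<in>K. c k * (real (k i) * real (k i - 1)) *
       (gauss_density x s y * monomial (k(i := k i - 2)) y)) = gauss_density x s y * laplacian V y"
        unfolding c laplacian_monomial_sum by (simp add: sum_distrib_left mult_ac)
      then show ?thesis using V by (simp add: solid_harmonic_def)
    qed
    ultimately show ?thesis by (simp add: has_bochner_integral_iff)
  qed
  have "(W has_real_derivative 0) (at s)" if "s > 0" for s
  proof -
    have "(W has_real_derivative (\<Sum>k\<in>K. c k * (\<Sum>i\<in>UNIV. s * (real (k i) * real (k i - 1) * normal_poly (k i - 2) (x $ i) s)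
        * (\<Prod>j\<in>UNIV - {i}. normal_poly (k j) (x $ j) s)))) (at s)"
      unfolding W_def
      by (intro DERIV_sum DERIV_cmult has_field_derivative_prod DERIV_normal_poly)
    also have "(\<Sum>k\<in>K. c k * (\<Sum>i\<in>UNIV. s * (real (k i) * real (k i - 1) * normal_poly (k i - 2) (x $ i) s)
        * (\<Prod>j\<in>UNIV - {i}. normal_poly (k j) (x $ j) s)))
      = s * (\<Sum>i\<in>UNIV. \<Sum>k\<in>K. c k * (real (k i) * real (k i - 1)) *
      (\<Prod>j\<in>UNIV. normal_poly ((k(i := k i - 2)) j) (x $ j) s))"
      unfolding prod_fun_upd_split[of "\<lambda>j m. normal_poly m (x $ j) s"]
      by (subst sum.swap) (simp add: sum_distrib_left mult_ac)
    finally show ?thesis using zero[OF that] by simp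
  qed
  \<comment> \<open>The derivative is known only for positive deviation; continuity carries
    constancy to the endpoint 0.\<close>
  moreover have "continuous_on {0..\<sigma>} W"
    unfolding W_def normal_poly_def by (intro continuous_intros)
  ultimately have "W \<sigma> = W 0"
    using DERIV_isconst_end[of 0 \<sigma> W] assms(2) by auto
  moreover have "W 0 = V x" by (simp add: W_def c monomial_def)
  ultimately show ?thesis using W[OF assms(2)] by simp
qed

lemma solid_harmonic_scale:
  assumes "solid_harmonic l V"
  shows "V (a *\<^sub>R x) = a ^ l * V x"
proof -
  obtain c where c: "V = (\<lambda>x. \<Sum>k | (\<Sum>i\<in>UNIV. k i) = l. c k * monomial k x)"
    using solid_harmonic_monomial_sum[OF assms] .
  have "monomial k (a *\<^sub>R x) = a ^ l * monomial k x" if "(\<Sum>i\<in>UNIV. k i) = l" for k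
    using that by (simp add: monomial_def power_mult_distrib prod.distrib power_sum[symmetric])
  then show ?thesis by (simp add: c sum_distrib_left mult_ac)
qed

lemma continuous_on_solid_harmonic:
  assumes "solid_harmonic l V"
  shows "continuous_on S V"
proof -
  obtain c where c: "V = (\<lambda>x. \<Sum>k | (\<Sum>i\<in>UNIV. k i) = l. c k * monomial k x)"
    using solid_harmonic_monomial_sum[OF assms] .
  show ?thesis unfolding c monomial_def by (intro continuous_intros)
qed

text \<open>The constant 1 is the nonnegative comparison case: integrability for a general
  \<open>V\<close> is later reduced to it.\<close>

lemma solid_harmonic_one: "solid_harmonic 0 (\<lambda>_ :: real ^ 'd. 1)"
proof -
  have "{k :: 'd \<Rightarrow> nat. (\<Sum>i\<in>UNIV. k i) = 0} = {\<lambda>_. 0}" by auto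
  then show ?thesis
    by (auto simp: solid_harmonic_def homogeneous_polynomial_def laplacian_def partial_deriv_def intro!: exI[of _ "\<lambda>_. 1"])
qed

text \<open>Completing the square turns the two exponentials into a multiple of a Gaussian density
  centred at \<open>(t / (t + z)) *\<^sub>R x\<close> with variance
  \<open>1 / (2 * (t + z))\<close>. The mean value property evaluates \<open>V\<close> at that
  centre, and homogeneity extracts the power of \<open>t / (t + z)\<close>.\<close>

lemma gauss_integral_solid_harmonic:
  fixes V :: "real ^ 'd \<Rightarrow> real"
  assumes "solid_harmonic l V" "t > 0" "z > 0"
  shows "has_bochner_integral lborel (\<lambda>y. exp (- t * (norm (x - y))\<^sup>2) * exp (- z * (norm y)\<^sup>2) * V y)
     ((pi / (t + z)) powr (CARD('d) / 2) * (t / (t + z)) ^ l * exp (- t * z / (t + z) * (norm x)\<^sup>2) * V x)"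
proof -
  define \<sigma> where "\<sigma> = sqrt (1 / (2 * (t + z)))"
  have tz: "t + z > 0" using assms by simp
  have \<sigma>: "\<sigma> > 0" "\<sigma>\<^sup>2 = 1 / (2 * (t + z))" using tz by (auto simp: \<sigma>_def)
  define c where "c = (t / (t + z)) *\<^sub>R x"
  define E where "E = exp (- t * z / (t + z) * (norm x)\<^sup>2)"
  define P where "P = (pi / (t + z)) powr (CARD('d) / 2)"
  have "2 * pi * \<sigma>\<^sup>2 = pi / (t + z)"
    unfolding \<sigma>(2) using tz by (simp add: divide_simps)
  then have "sqrt (2 * pi * \<sigma>\<^sup>2) = (pi / (t + z)) powr (1 / 2)"
    using tz by (simp add: powr_half_sqrt)
  then have P: "(1 / sqrt (2 * pi * \<sigma>\<^sup>2)) ^ CARD('d) = 1 / P" "P > 0"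
    using tz by (auto simp: P_def power_divide powr_powr simp flip: powr_realpow)
  have eq: "exp (- t * (norm (x - y))\<^sup>2) * exp (- z * (norm y)\<^sup>2) * V y = P * E * (gauss_density c \<sigma> y * V y)" for y
  proof -
    have "(norm (y - c))\<^sup>2 = (norm y)\<^sup>2 - 2 * (t / (t + z)) * (y \<bullet> x) + (t / (t + z))\<^sup>2 * (norm x)\<^sup>2"
      unfolding c_def power2_norm_eq_inner
      by (simp add: inner_diff inner_commute[of x y] power2_eq_square algebra_simps)
    moreover have "(norm (x - y))\<^sup>2 = (norm y)\<^sup>2 - 2 * (y \<bullet> x) + (norm x)\<^sup>2"
      unfolding power2_norm_eq_inner
      by (simp add: inner_diff inner_commute[of x y] algebra_simps)
    moreover have "2 * \<sigma>\<^sup>2 = 1 / (t + z)" unfolding \<sigma>(2) using tz by (simp add: divide_simps)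
    \<comment> \<open>The completed square, with \<open>Y\<close>, \<open>X\<close> and
      \<open>p\<close> standing for the squared norms of \<open>y\<close> and \<open>x\<close> and
      their inner product.\<close>
    moreover have "- t * (Y - 2 * p + X) + - z * Y = - t * z / (t + z) * X + - (Y - 2 * (t / (t + z)) * p + (t / (t + z))\<^sup>2 * X) / (1 / (t + z))"
      for X Y p
      using tz by (simp add: divide_simps) (simp add: power2_eq_square algebra_simps)
    ultimately have "- t * (norm (x - y))\<^sup>2 + - z * (norm y)\<^sup>2 = - t * z / (t + z) * (norm x)\<^sup>2 + - (norm (y - c))\<^sup>2 / (2 * \<sigma>\<^sup>2)"
      by simp
    then show ?thesis unfolding gauss_density_eq P(1) E_def exp_add[symmetric] using P(2)
      by (simp flip: exp_add)
  qed
  have Vc: "V c = (t / (t + z)) ^ l * V x" unfolding c_def by (rule solid_harmonic_scale[OF assms(1)])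
  have "has_bochner_integral lborel (\<lambda>y. P * E * (gauss_density c \<sigma> y * V y)) (P * E * V c)"
    by (intro has_bochner_integral_mult_right gauss_mean_value_solid_harmonic[OF assms(1) \<sigma>(1)])
  then show ?thesis unfolding eq Vc by (simp add: P_def E_def mult_ac)
qed

subsection \<open>Gamma and Beta integrals\<close>

text \<open>A bridge between Bochner integrals over \<open>lborel\<close> and gauge integrals on
  sets, where the Gamma and Beta integrals and the change of variables are available. For Borel
  functions, passing to the completed measure changes nothing.\<close>

lemma has_bochner_integral_lborel_indicator_iff:
  fixes f :: "'a::euclidean_space \<Rightarrow> real"
  assumes [measurable]: "f \<in> borel_measurable borel" "S \<in> sets borel"
  shows "has_bochner_integral lborel (\<lambda>x. indicator S x * f x) b \<longleftrightarrow>
    f absolutely_integrable_on S \<and> integral S f = b"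
proof -
  have m: "(\<lambda>x. indicator S x * f x) \<in> borel_measurable lborel" by measurable
  have 1: "f absolutely_integrable_on S \<longleftrightarrow> integrable lborel (\<lambda>x. indicator S x * f x)"
    unfolding set_integrable_def using integrable_completion[OF m] by simp
  have 2: "integral S f = integral\<^sup>L lborel (\<lambda>x. indicator S x * f x)" if "f absolutely_integrable_on S"
    using set_lebesgue_integral_eq_integral(2)[OF that] integral_completion[OF m]
    by (simp add: set_lebesgue_integral_def)
  show ?thesis unfolding has_bochner_integral_iff using 1 2 by auto
qed

lemma has_bochner_integral_lborel_indicator_nonneg:
  fixes f :: "'a::euclidean_space \<Rightarrow> real"
  assumes "f \<in> borel_measurable borel" "S \<in> sets borel" "(f has_integral b) S" "\<And>x. x \<in> S \<Longrightarrow> f x \<ge> 0"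
  shows "has_bochner_integral lborel (\<lambda>x. indicator S x * f x) b"
  unfolding has_bochner_integral_lborel_indicator_iff[OF assms(1,2)]
  using assms(3,4) by (auto intro: nonnegative_absolutely_integrable_1)

lemma has_bochner_integral_Gamma:
  fixes p a :: real
  assumes "p > 0" "a > 0"
  shows "has_bochner_integral lborel (\<lambda>t. indicator {0<..} t * (t powr (p - 1) * exp (- a * t))) (Gamma p * a powr - p)"
proof -
  have "has_bochner_integral lborel (\<lambda>t. indicator {0<..} t * (t powr (p - 1) * exp (- t))) (Gamma p)"
  proof (rule has_bochner_integral_lborel_indicator_nonneg)
    show "((\<lambda>t. t powr (p - 1) * exp (- t)) has_integral Gamma p) {0<..}"
    proof -
      have "((\<lambda>t. t powr (p - 1) * exp (- t)) has_integral Gamma p) {0..}"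
        using Gamma_integral_real[OF assms(1)] by (simp add: exp_minus divide_inverse)
      then have "((\<lambda>t. if t \<in> {0<..} then t powr (p - 1) * exp (- t) else 0) has_integral Gamma p) {0..}"
        by (rule has_integral_spike [of "{0}", rotated 2]) auto
      then show ?thesis by (subst (asm) has_integral_restrict) auto
    qed
  qed auto
  then have "has_bochner_integral lborel (\<lambda>t. indicator {0<..} (0 + a * t) * ((0 + a * t) powr (p - 1) * exp (- (0 + a * t)))) (Gamma p /\<^sub>R \<bar>a\<bar>)"
    using assms(2) lborel_has_bochner_integral_real_affine_iff[of a
      "\<lambda>t. indicator {0<..} t * (t powr (p - 1) * exp (- t))" "Gamma p" 0] by blast
  then have "has_bochner_integral lborel (\<lambda>t. a powr (1 - p) * (indicator {0<..} (0 + a * t) * ((0 + a * t) powr (p - 1) * exp (- (0 + a * t)))))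
     (a powr (1 - p) * (Gamma p /\<^sub>R \<bar>a\<bar>))"
    by (rule has_bochner_integral_mult_right)
  moreover have "a powr (1 - p) * (indicator {0<..} (0 + a * t) * ((0 + a * t) powr (p - 1) * exp (- (0 + a * t))))
     = indicator {0<..} t * (t powr (p - 1) * exp (- a * t))" for t
  proof -
    have "a powr (1 - p) * a powr (p - 1) = 1" using assms(2) by (simp flip: powr_add)
    then show ?thesis using assms(2) by (simp add: indicator_def powr_mult zero_less_mult_iff)
  qed
  moreover have "a powr (1 - p) * (Gamma p /\<^sub>R \<bar>a\<bar>) = Gamma p * a powr - p"
    using assms(2) by (simp add: powr_diff powr_minus divide_inverse)
  ultimately show ?thesis by (simp only:)
qed

lemma has_bochner_integral_Beta:
  assumes "p > 0" "q > (0::real)"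
  shows "has_bochner_integral lborel (\<lambda>u. indicator {0<..<1} u * (u powr (p - 1) * (1 - u) powr (q - 1))) (Beta p q)"
proof (rule has_bochner_integral_lborel_indicator_nonneg)
  show "((\<lambda>u. u powr (p - 1) * (1 - u) powr (q - 1)) has_integral Beta p q) {0<..<1}"
    using has_integral_Beta_real[OF assms] by (simp add: has_integral_Icc_iff_Ioo)
qed auto

text \<open>Scaling by \<open>w = 1 - v\<close> maps the unit interval onto the support in \<sigma>.
  The integrand contributes \<open>w\<close> to the power \<open>p + q - 2\<close>, and the Jacobian
  one more factor.\<close>

lemma has_bochner_integral_Beta_shifted:
  assumes "p > 0" "q > (0::real)" "v < 1"
  shows "has_bochner_integral lborel
    (\<lambda>\<sigma>. indicator {0<..} \<sigma> * \<sigma> powr (p - 1) * (if v + \<sigma> < 1 then (1 - (v + \<sigma>)) powr (q - 1) else 0))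
    (Beta p q * (1 - v) powr (p + q - 1))"
proof -
  define w where "w = 1 - v"
  have w: "w > 0" using assms by (simp add: w_def)
  let ?f = "\<lambda>\<sigma>. indicator {0<..} \<sigma> * \<sigma> powr (p - 1) * (if v + \<sigma> < 1 then (1 - (v + \<sigma>)) powr (q - 1) else 0)"
  have "?f (0 + w * u) = w powr (p + q - 2) * (indicator {0<..<1} u * (u powr (p - 1) * (1 - u) powr (q - 1)))" for u
  proof (cases "0 < u \<and> u < 1")
    case True
    have "w * (1 - u) > 0" using True w by simp
    moreover have eq: "1 - (v + w * u) = w * (1 - u)" by (simp add: w_def algebra_simps)
    ultimately have "v + w * u < 1" by linarith
    moreover have "w powr (p + q - 2) = w powr (p - 1) * w powr (q - 1)"
      by (simp flip: powr_add)
    ultimately show ?thesis using True w eq by (simp add: powr_mult)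
  next
    case False
    have "v + w * u \<ge> 1" if "u \<ge> 1" using mult_left_mono[OF that, of w] w w_def by linarith
    then show ?thesis using False w by (auto simp: indicator_def zero_less_mult_iff)
  qed
  then have eq: "(\<lambda>u. ?f (0 + w * u)) = (\<lambda>u. w powr (p + q - 2) * (indicator {0<..<1} u * (u powr (p - 1) * (1 - u) powr (q - 1))))"
    by (rule ext)
  have "has_bochner_integral lborel (\<lambda>u. ?f (0 + w * u)) (w powr (p + q - 2) * Beta p q)"
    unfolding eq by (intro has_bochner_integral_mult_right has_bochner_integral_Beta assms)
  moreover have "w powr (p + q - 2) * Beta p q = (Beta p q * w powr (p + q - 1)) /\<^sub>R \<bar>w\<bar>"
  proof -
    have "w powr (p + q - 1) = w powr (p + q - 2) * w"
      using w powr_add[of w "p + q - 2" 1] by simp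
    then show ?thesis using w by simp
  qed
  ultimately have "has_bochner_integral lborel (\<lambda>u. ?f (0 + w * u)) ((Beta p q * w powr (p + q - 1)) /\<^sub>R \<bar>w\<bar>)"
    by (simp only:)
  then show ?thesis
    unfolding w_def[symmetric] using w
    by (intro iffD2[OF lborel_has_bochner_integral_real_affine_iff[of w ?f _ 0]]) simp_all
qed

text \<open>The substitution is \<open>u = t / (t + z)\<close>, inverted by
  \<open>t = z * u / (1 - u)\<close>. Then \<open>t + z = z / (1 - u)\<close>, and the exponent
  \<open>t * z / (t + z)\<close> becomes the linear \<open>z * u\<close>. The change of variables
  theorem carries absolute integrability along with the value.\<close>

lemma has_bochner_integral_rational_substitution:
  fixes A h z r :: real
  assumes "z > 0" and I: "has_bochner_integral lborel (\<lambda>u. indicator {0<..<1} u * (u powr (A - 1) * (1 - u) powr (h - 1) * exp (- r * z * u))) I"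
  shows "has_bochner_integral lborel
    (\<lambda>t. indicator {0<..} t * (t powr (A - 1) * (t + z) powr - (A + h) * exp (- t * z / (t + z) * r))) (z powr - h * I)"
proof -
  define f where "f t = t powr (A - 1) * (t + z) powr - (A + h) * exp (- t * z / (t + z) * r)" for t
  define g where "g u = z * u / (1 - u)" for u
  define g' where "g' u = z / (1 - u)\<^sup>2" for u
  have fg: "\<bar>g' u\<bar> * f (g u) = z powr - h * (u powr (A - 1) * (1 - u) powr (h - 1) * exp (- r * z * u))"
    if u: "0 < u" "u < 1" for u
  proof -
    have gz: "g u + z = z / (1 - u)" using u by (simp add: g_def field_simps)
    have e: "- g u * z / (g u + z) * r = - r * z * u" unfolding gz using u assms(1) by (simp add: g_def)
    \<comment> \<open>Every factor is written as an exponential of logarithms, so only linear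
      combinations of \<open>ln z\<close>, \<open>ln u\<close> and \<open>ln (1 - u)\<close> have to
      agree.\<close>
    have p: "(g u) powr (A - 1) * (z / (1 - u)) powr - (A + h) * \<bar>g' u\<bar> = z powr - h * (u powr (A - 1) * (1 - u) powr (h - 1))"
    proof -
      have "(g u) powr (A - 1) = exp ((A - 1) * (ln z + ln u - ln (1 - u)))"
        using u assms(1) by (simp add: g_def powr_def ln_mult ln_div)
      moreover have "(z / (1 - u)) powr - (A + h) = exp (- (A + h) * (ln z - ln (1 - u)))"
        using u assms(1) by (simp add: powr_def ln_div)
      moreover have "\<bar>g' u\<bar> = exp (ln z - 2 * ln (1 - u))"
        using u assms(1) by (simp add: g'_def exp_diff exp_double)
      moreover have "z powr - h * (u powr (A - 1) * (1 - u) powr (h - 1)) = exp (- h * ln z + (A - 1) * ln u + (h - 1) * ln (1 - u))"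
        using u assms(1) by (simp add: powr_def) (simp flip: exp_add)
      ultimately show ?thesis by (simp add: exp_add[symmetric] algebra_simps)
    qed
    show ?thesis unfolding f_def e unfolding gz using p by (simp add: mult_ac)
  qed
  have g: "g ` {0<..<1} = {0<..}"
  proof (intro equalityI subsetI)
    fix t :: real assume "t \<in> {0<..}"
    then have t: "t > 0" by simp
    then have "1 - t / (t + z) = z / (t + z)" using assms(1) by (simp add: field_simps)
    then have "t = g (t / (t + z))" "t / (t + z) \<in> {0<..<1}"
      using assms(1) t by (auto simp: g_def)
    then show "t \<in> g ` {0<..<1}" by blast
  qed (use assms in \<open>auto simp: g_def\<close>)
  have inj: "inj_on g {0<..<1}"
  proof (rule inj_on_inverseI)
    fix u :: real assume "u \<in> {0<..<1}"
    moreover from this have "g u + z = z / (1 - u)" by (simp add: g_def field_simps)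
    ultimately show "g u / (g u + z) = u" using assms(1) by (simp add: g_def)
  qed
  have "has_bochner_integral lborel (\<lambda>u. z powr - h * (indicator {0<..<1} u * (u powr (A - 1) * (1 - u) powr (h - 1) * exp (- r * z * u)))) (z powr - h * I)"
    by (intro has_bochner_integral_mult_right I)
  also have "(\<lambda>u. z powr - h * (indicator {0<..<1} u * (u powr (A - 1) * (1 - u) powr (h - 1) * exp (- r * z * u))))
     = (\<lambda>u. indicator {0<..<1} u * (\<bar>g' u\<bar> * f (g u)))"
    using fg by (auto simp: fun_eq_iff indicator_def)
  finally have *: "has_bochner_integral lborel (\<lambda>u. indicator {0<..<1} u * (\<bar>g' u\<bar> * f (g u))) (z powr - h * I)" .
  have "(\<lambda>u. \<bar>g' u\<bar> * f (g u)) absolutely_integrable_on {0<..<1} \<and> integral {0<..<1} (\<lambda>u. \<bar>g' u\<bar> * f (g u)) = z powr - h * I"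
    by (rule iffD1[OF has_bochner_integral_lborel_indicator_iff *]) (auto simp: f_def g_def g'_def)
  moreover have "(\<lambda>u. \<bar>g' u\<bar> * f (g u)) absolutely_integrable_on {0<..<1} \<and> integral {0<..<1} (\<lambda>u. \<bar>g' u\<bar> * f (g u)) = z powr - h * I
    \<longleftrightarrow> f absolutely_integrable_on (g ` {0<..<1}) \<and> integral (g ` {0<..<1}) f = z powr - h * I"
  proof (rule has_absolute_integral_change_of_variables_1')
    show "(g has_field_derivative g' u) (at u within {0<..<1})" if "u \<in> {0<..<1}" for u
    proof -
      have "(g has_field_derivative ((z * 1) * (1 - u) - (z * u) * (0 - 1)) / ((1 - u) * (1 - u))) (at u within {0<..<1})"
        unfolding g_def using that
        by (intro DERIV_divide DERIV_cmult DERIV_diff DERIV_const DERIV_ident) auto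
      moreover have "((z * 1) * (1 - u) - (z * u) * (0 - 1)) / ((1 - u) * (1 - u)) = g' u"
        by (simp add: g'_def power2_eq_square algebra_simps)
      ultimately show ?thesis by simp
    qed
  qed (use inj in auto)
  ultimately have "f absolutely_integrable_on (g ` {0<..<1}) \<and> integral (g ` {0<..<1}) f = z powr - h * I"
    by simp
  then show ?thesis
    unfolding g f_def by (intro iffD2[OF has_bochner_integral_lborel_indicator_iff]) auto
qed

text \<open>Fubini in a form that passes a known iterated integral to the other order. The fibre
  hypotheses hold only almost everywhere because a singular kernel has a bad fibre at its
  pole.\<close>

lemma has_bochner_integral_lborel_pair_swap:
  fixes F :: "'a::euclidean_space \<times> 'b::euclidean_space \<Rightarrow> real"
  assumes F: "integrable (lborel \<Otimes>\<^sub>M lborel) F"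
    and G: "AE x in lborel. has_bochner_integral lborel (\<lambda>y. F (x, y)) (G x)"
    and H: "AE y in lborel. has_bochner_integral lborel (\<lambda>x. F (x, y)) (H y)"
    and [measurable]: "H \<in> borel_measurable borel"
    and c: "has_bochner_integral lborel G c"
  shows "has_bochner_integral lborel H c"
proof -
  have 1: "AE x in lborel. (\<integral>y. F (x, y) \<partial>lborel) = G x" "AE y in lborel. (\<integral>x. F (x, y) \<partial>lborel) = H y"
    using G H by (auto elim!: eventually_mono simp: has_bochner_integral_iff)
  have F': "integrable (lborel \<Otimes>\<^sub>M lborel) (\<lambda>(x, y). F (x, y))" using F by simp
  have m [measurable]: "G \<in> borel_measurable lborel" using c by (auto simp: has_bochner_integral_iff)
  have [measurable]: "F \<in> borel_measurable (lborel \<Otimes>\<^sub>M lborel)" using F by auto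
  have "integrable lborel H"
    using lborel_pair.integrable_snd[OF F'] by (subst integrable_cong_AE[of _ _ "\<lambda>y. \<integral>x. F (x, y) \<partial>lborel"]) (use 1(2) in auto)
  moreover have "integral\<^sup>L lborel H = integral\<^sup>L lborel G"
  proof -
    have "integral\<^sup>L lborel H = (\<integral>y. (\<integral>x. F (x, y) \<partial>lborel) \<partial>lborel)"
      by (intro integral_cong_AE) (use 1(2) in auto)
    also have "\<dots> = (\<integral>x. (\<integral>y. F (x, y) \<partial>lborel) \<partial>lborel)"
      using lborel_pair.integral_snd[OF F'] lborel_pair.integral_fst[OF F'] by simp
    also have "\<dots> = integral\<^sup>L lborel G"
      by (intro integral_cong_AE) (use 1(1) in auto)
    finally show ?thesis .
  qed
  ultimately show ?thesis using c by (simp add: has_bochner_integral_iff)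
qed

lemma has_bochner_integral_lborel_pair_nonneg:
  fixes F :: "'a::euclidean_space \<times> 'b::euclidean_space \<Rightarrow> real"
  assumes [measurable]: "F \<in> borel_measurable (lborel \<Otimes>\<^sub>M lborel)"
    and nonneg: "\<And>p. F p \<ge> 0"
    and G: "\<And>x. has_bochner_integral lborel (\<lambda>y. F (x, y)) (G x)"
    and c: "has_bochner_integral lborel G c"
  shows "has_bochner_integral (lborel \<Otimes>\<^sub>M lborel) F c"
proof -
  have i: "integrable (lborel \<Otimes>\<^sub>M lborel) F"
    using G c nonneg by (intro lborel_pair.Fubini_integrable) (auto simp: has_bochner_integral_iff)
  then have "integrable (lborel \<Otimes>\<^sub>M lborel) (\<lambda>(x, y). F (x, y))" by simp
  from lborel_pair.integral_fst[OF this] i show ?thesis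
    using G c by (simp add: has_bochner_integral_iff)
qed

subsection \<open>The Riesz kernel against Gaussians\<close>

lemma solid_harmonic_norm_bound:
  fixes V :: "real ^ 'd \<Rightarrow> real"
  assumes "solid_harmonic l V"
  obtains M where "M \<ge> 0" "\<And>y. \<bar>V y\<bar> \<le> M * norm y ^ l"
proof -
  obtain c where c: "V = (\<lambda>x. \<Sum>k | (\<Sum>i\<in>UNIV. k i) = l. c k * monomial k x)"
    using solid_harmonic_monomial_sum[OF assms] .
  have "\<bar>monomial k y\<bar> \<le> norm y ^ l" if "(\<Sum>i\<in>UNIV. k i) = l" for k y
  proof -
    have "\<bar>monomial k y\<bar> = (\<Prod>i\<in>UNIV. \<bar>y $ i\<bar> ^ k i)"
      by (simp add: monomial_def abs_prod power_abs)
    also have "\<dots> \<le> (\<Prod>i\<in>UNIV. norm y ^ k i)"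
      by (intro prod_mono conjI power_mono component_le_norm_cart) auto
    finally show ?thesis using that by (simp flip: power_sum)
  qed
  then have "\<bar>V y\<bar> \<le> (\<Sum>k | (\<Sum>i\<in>UNIV. k i) = l. \<bar>c k\<bar> * norm y ^ l)" for y
    unfolding c by (intro order_trans[OF sum_abs] sum_mono) (auto simp: abs_mult intro!: mult_left_mono)
  then show ?thesis
    by (intro that[of "\<Sum>k | (\<Sum>i\<in>UNIV. k i) = l. \<bar>c k\<bar>"]) (auto simp: sum_distrib_right intro: sum_nonneg)
qed

text \<open>The chain is \<open>s \<le> 1 + s\<^sup>2 \<le> K * (1 + w * s\<^sup>2 / l)\<close>,
  raised to the power \<open>l\<close> and combined with \<open>(1 + a / l)^l \<le> exp a\<close>.
  It lets part of a Gaussian absorb polynomial growth.\<close>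

lemma power_le_exp_square:
  fixes w :: real
  assumes "w > 0"
  obtains C where "C \<ge> 0" "\<And>s. s \<ge> 0 \<Longrightarrow> s ^ l \<le> C * exp (w * s\<^sup>2)"
proof (cases "l = 0")
  case True
  show ?thesis
    using assms by (intro that[of 1]) (auto simp: True)
next
  case False
  define K where "K = 1 + real l / w"
  have "s ^ l \<le> K ^ l * exp (w * s\<^sup>2)" if "s \<ge> 0" for s
  proof -
    have "s \<le> 1 + s\<^sup>2" using zero_le_power2[of "s - 1"] that by (simp add: power2_diff)
    also have "\<dots> \<le> K * (1 + w * s\<^sup>2 / real l)"
      using assms False by (simp add: K_def field_simps)
    finally have "s ^ l \<le> (K * (1 + w * s\<^sup>2 / real l)) ^ l" using that by (intro power_mono)
    also have "\<dots> \<le> K ^ l * exp (w * s\<^sup>2)"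
      unfolding power_mult_distrib using assms False
      by (intro mult_left_mono exp_ge_one_plus_x_over_n_power_n) (auto simp: K_def intro: order_trans[of _ 0])
    finally show ?thesis .
  qed
  then show ?thesis using assms by (intro that[of "K ^ l"]) (auto simp: K_def)
qed

lemma integrable_Beta_weight:
  fixes p q :: real
  assumes "p > 0" "q > 0" and [measurable]: "w \<in> borel_measurable borel"
    and B: "\<And>u. 0 < u \<Longrightarrow> u < 1 \<Longrightarrow> \<bar>w u\<bar> \<le> B"
  shows "integrable lborel (\<lambda>u. indicator {0<..<1} u * (u powr (p - 1) * (1 - u) powr (q - 1) * w u))"
proof (rule Bochner_Integration.integrable_bound)
  show "integrable lborel (\<lambda>u. B * (indicator {0<..<1} u * (u powr (p - 1) * (1 - u) powr (q - 1))))"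
    using has_bochner_integral_Beta[OF assms(1,2)] by (auto simp: has_bochner_integral_iff)
  show "AE u in lborel. norm (indicator {0<..<1} u * (u powr (p - 1) * (1 - u) powr (q - 1) * w u))
     \<le> norm (B * (indicator {0<..<1} u * (u powr (p - 1) * (1 - u) powr (q - 1))))"
  proof (intro AE_I2)
    fix u :: real
    have "\<bar>w u\<bar> \<le> \<bar>B\<bar>" if "0 < u" "u < 1" using B[OF that] by simp
    then show "norm (indicator {0<..<1} u * (u powr (p - 1) * (1 - u) powr (q - 1) * w u))
     \<le> norm (B * (indicator {0<..<1} u * (u powr (p - 1) * (1 - u) powr (q - 1))))"
      by (auto simp: indicator_def abs_mult mult_ac intro!: mult_mono mult_left_mono)
  qed
qed measurable

abbreviation Beta_integral :: "real \<Rightarrow> real \<Rightarrow> (real \<Rightarrow> real) \<Rightarrow> real" where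
  "Beta_integral p q w \<equiv> (\<integral>u. indicator {0<..<1} u * (u powr (p - 1) * (1 - u) powr (q - 1) * w u) \<partial>lborel)"

lemma has_bochner_integral_Beta_exp:
  fixes p q s :: real
  assumes "p > 0" "q > 0" "s \<ge> 0"
  shows "has_bochner_integral lborel (\<lambda>u. indicator {0<..<1} u * (u powr (p - 1) * (1 - u) powr (q - 1) * exp (- s * u)))
     (Beta_integral p q (\<lambda>u. exp (- s * u)))"
  using assms by (auto simp: has_bochner_integral_iff intro!: integrable_Beta_weight[where B = 1])

text \<open>The kernel is \<open>1 / Gamma b\<close> times the Gamma integral of
  \<open>t powr (b - 1) * exp (- t * (norm (x - y))\<^sup>2)\<close>. After exchanging integrals,
  the integral over \<open>y\<close> is Gaussian and the one over \<open>t\<close> is handled by the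
  rational substitution. The condition \<open>b + h = d / 2\<close> gives \<open>t + z\<close> the
  matching exponent \<open>-(b + l + h)\<close>.\<close>

lemma has_bochner_integral_riesz_gauss:
  fixes V :: "real ^ 'd \<Rightarrow> real"
  assumes V: "solid_harmonic l V" and b: "b > 0" and h: "h > 0" and bh: "b + h = CARD('d) / 2" and z: "z > 0"
  shows "has_bochner_integral lborel (\<lambda>y. exp (- z * (norm y)\<^sup>2) * V y * norm (x - y) powr (- 2 * b))
    (V x * (pi powr (CARD('d) / 2) / Gamma b) * (z powr - h * Beta_integral (b + l) h (\<lambda>u. exp (- ((norm x)\<^sup>2 * z) * u))))"
proof -
  note [measurable] = borel_measurable_continuous_onI[OF continuous_on_solid_harmonic[OF V]]
  define P where "P = pi powr (CARD('d) / 2)"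
  \<comment> \<open>Polynomial and rate stay free, so that the same formulas serve \<open>V\<close>
    at rate \<open>z\<close> and the dominating constant 1 at rate \<open>z / 2\<close>.\<close>
  define F where "F U w = (\<lambda>(t :: real, y :: real ^ 'd). indicator {0<..} t * (t powr (b - 1) *
      (exp (- t * (norm (x - y))\<^sup>2) * exp (- w * (norm y)\<^sup>2) * U y)))" for U w
  define G where "G U k w = (\<lambda>t :: real. indicator {0<..} t * (t powr (b - 1) *
    ((pi / (t + w)) powr (CARD('d) / 2) * (t / (t + w)) ^ k * exp (- t * w / (t + w) * (norm x)\<^sup>2) * U x)))"
    for U :: "real ^ 'd \<Rightarrow> real" and k w
  have FG: "has_bochner_integral lborel (\<lambda>y. F U w (t, y)) (G U k w t)" if "solid_harmonic k U" "w > 0" for U k w t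
  proof (cases "t > 0")
    case True
    show ?thesis unfolding F_def G_def prod.case
      by (intro has_bochner_integral_mult_right gauss_integral_solid_harmonic that True)
  qed (auto simp: F_def G_def intro: has_bochner_integral_zero)
  have G: "has_bochner_integral lborel (G U k w)
      (U x * P * (w powr - h * Beta_integral (b + k) h (\<lambda>u. exp (- ((norm x)\<^sup>2 * w) * u))))" if w: "w > 0" for U k w
  proof -
    have eq: "G U k w t = U x * P * (indicator {0<..} t * (t powr (b + k - 1) * (t + w) powr - (b + k + h) * exp (- t * w / (t + w) * (norm x)\<^sup>2)))" for t
    proof (cases "t > 0")
      case True
      have "(t / (t + w)) ^ k = t powr k * (t + w) powr - real k"
        using True w by (simp add: power_mult_distrib power_inverse powr_minus powr_realpow divide_inverse)
      moreover have "(pi / (t + w)) powr (CARD('d) / 2) = P * (t + w) powr - (b + h)"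
        unfolding bh using True w by (simp add: P_def powr_divide powr_minus_divide)
      moreover have "t powr (b + k - 1) = t powr (b - 1) * t powr k"
        using powr_add[of t "b - 1" "real k"] by (simp add: add_diff_eq diff_add_eq)
      moreover have "(t + w) powr - (b + k + h) = (t + w) powr - (b + h) * (t + w) powr - real k"
      proof -
        have "- (b + k + h) = - (b + h) + - real k" by simp
        then show ?thesis by (simp only: powr_add)
      qed
      ultimately show ?thesis using True by (simp add: G_def)
    qed (simp add: G_def)
    show ?thesis unfolding eq
    proof (intro has_bochner_integral_mult_right has_bochner_integral_rational_substitution w)
      show "has_bochner_integral lborel (\<lambda>u. indicator {0<..<1} u * (u powr (b + k - 1) * (1 - u) powr (h - 1) * exp (- (norm x)\<^sup>2 * w * u)))
        (Beta_integral (b + k) h (\<lambda>u. exp (- ((norm x)\<^sup>2 * w) * u)))"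
        using has_bochner_integral_Beta_exp[of "b + k" h "(norm x)\<^sup>2 * w"] b h w by simp
    qed
  qed
  obtain M where M: "M \<ge> 0" "\<And>y. \<bar>V y\<bar> \<le> M * norm y ^ l" using solid_harmonic_norm_bound[OF V] by blast
  obtain C where C: "C \<ge> 0" "\<And>s. s \<ge> 0 \<Longrightarrow> s ^ l \<le> C * exp (z / 2 * s\<^sup>2)" using power_le_exp_square[of "z / 2" l] z by auto
  \<comment> \<open>Half of the Gaussian exponent pays for the growth of \<open>V\<close>; the
    remaining bound is nonnegative, so Tonelli yields integrability on the product.\<close>
  have Vb: "exp (- z * (norm y)\<^sup>2) * \<bar>V y\<bar> \<le> M * C * exp (- (z / 2) * (norm y)\<^sup>2)" for y
  proof -
    have "\<bar>V y\<bar> \<le> M * (C * exp (z / 2 * (norm y)\<^sup>2))"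
      using M C(2)[of "norm y"] by (meson mult_left_mono norm_ge_zero order_trans)
    then have "exp (- z * (norm y)\<^sup>2) * \<bar>V y\<bar> \<le> exp (- z * (norm y)\<^sup>2) * (M * (C * exp (z / 2 * (norm y)\<^sup>2)))"
      by (intro mult_left_mono) auto
    also have "\<dots> = M * C * (exp (- z * (norm y)\<^sup>2) * exp (z / 2 * (norm y)\<^sup>2))" by (simp add: mult_ac)
    also have "exp (- z * (norm y)\<^sup>2) * exp (z / 2 * (norm y)\<^sup>2) = exp (- (z / 2) * (norm y)\<^sup>2)"
      by (simp flip: exp_add)
    finally show ?thesis .
  qed
  have "has_bochner_integral (lborel \<Otimes>\<^sub>M lborel) (F (\<lambda>_. 1) (z / 2)) (1 * P * ((z / 2) powr - h * Beta_integral (b + real 0) h (\<lambda>u. exp (- ((norm x)\<^sup>2 * (z / 2)) * u))))"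
  proof (rule has_bochner_integral_lborel_pair_nonneg)
    show "F (\<lambda>_. 1) (z / 2) \<in> borel_measurable (lborel \<Otimes>\<^sub>M lborel)" unfolding F_def by measurable
    show "has_bochner_integral lborel (\<lambda>y. F (\<lambda>_. 1) (z / 2) (t, y)) (G (\<lambda>_. 1) 0 (z / 2) t)" for t
      using z by (intro FG solid_harmonic_one) auto
    show "has_bochner_integral lborel (G (\<lambda>_. 1) 0 (z / 2)) (1 * P * ((z / 2) powr - h * Beta_integral (b + real 0) h (\<lambda>u. exp (- ((norm x)\<^sup>2 * (z / 2)) * u))))"
      using z G[of "z / 2" "\<lambda>_. 1" 0] by simp
  qed (auto simp: F_def split: prod.splits)
  then have I0: "integrable (lborel \<Otimes>\<^sub>M lborel) (\<lambda>p. M * C * F (\<lambda>_. 1) (z / 2) p)"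
    by (auto simp: has_bochner_integral_iff)
  have I: "integrable (lborel \<Otimes>\<^sub>M lborel) (F V z)"
  proof (rule Bochner_Integration.integrable_bound[OF I0])
    show "F V z \<in> borel_measurable (lborel \<Otimes>\<^sub>M lborel)" unfolding F_def by measurable
    show "AE p in lborel \<Otimes>\<^sub>M lborel. norm (F V z p) \<le> norm (M * C * F (\<lambda>_. 1) (z / 2) p)"
    proof (intro AE_I2, clarify)
      fix t :: real and y :: "real ^ 'd"
      define q where "q = indicator {0<..} t * (t powr (b - 1) * exp (- t * (norm (x - y))\<^sup>2))"
      have q: "q \<ge> 0" by (simp add: q_def)
      have "norm (F V z (t, y)) = q * (exp (- z * (norm y)\<^sup>2) * \<bar>V y\<bar>)"
        by (simp add: F_def q_def abs_mult mult_ac)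
      also have "\<dots> \<le> q * (M * C * exp (- (z / 2) * (norm y)\<^sup>2))" by (intro mult_left_mono Vb q)
      also have "\<dots> = M * C * F (\<lambda>_. 1) (z / 2) (t, y)" by (simp add: F_def q_def mult_ac)
      finally show "norm (F V z (t, y)) \<le> norm (M * C * F (\<lambda>_. 1) (z / 2) (t, y))" by simp
    qed
  qed
  have "has_bochner_integral lborel (\<lambda>y. Gamma b * (exp (- z * (norm y)\<^sup>2) * V y * norm (x - y) powr (- 2 * b)))
     (V x * P * (z powr - h * Beta_integral (b + l) h (\<lambda>u. exp (- ((norm x)\<^sup>2 * z) * u))))"
  proof (rule has_bochner_integral_lborel_pair_swap[OF I _ _ _ G[OF z]])
    show "AE t in lborel. has_bochner_integral lborel (\<lambda>y. F V z (t, y)) (G V l z t)"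
      by (intro AE_I2 FG V z)
    \<comment> \<open>At \<open>y = x\<close> the exponential decay in \<open>t\<close> is lost and
      the Gamma integral diverges; this single point is a null set.\<close>
    have "AE y in lborel. y \<noteq> x" by (rule AE_lborel_singleton)
    then show "AE y in lborel. has_bochner_integral lborel (\<lambda>t. F V z (t, y))
        (Gamma b * (exp (- z * (norm y)\<^sup>2) * V y * norm (x - y) powr (- 2 * b)))"
    proof eventually_elim
      case (elim y)
      then have n: "norm (x - y) > 0" by simp
      then have e: "Gamma b * (exp (- z * (norm y)\<^sup>2) * V y * norm (x - y) powr (- 2 * b))
         = exp (- z * (norm y)\<^sup>2) * V y * (Gamma b * (norm (x - y))\<^sup>2 powr - b)"
        by (simp add: powr_powr mult_ac flip: powr_numeral)
      have F: "F V z (t, y) = exp (- z * (norm y)\<^sup>2) * V y * (indicator {0<..} t * (t powr (b - 1) * exp (- (norm (x - y))\<^sup>2 * t)))" for t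
        by (simp add: F_def mult_ac)
      show ?case unfolding e F using n by (intro has_bochner_integral_mult_right has_bochner_integral_Gamma b) simp
    qed
  qed measurable
  from has_bochner_integral_mult_right[OF this, of "1 / Gamma b"] show ?thesis
    using Gamma_real_pos[OF b] by (simp add: P_def mult_ac)
qed

text \<open>The integral over \<sigma> turns \<open>z powr - h\<close> into an integral of
  exponentials. Up to constants the value is that of
  \<open>has_bochner_integral_riesz_gauss\<close>, so the general identity holds for
  \<open>exp (- z * \<rho>)\<close>.\<close>

lemma has_bochner_integral_exp_pair:
  fixes A h z r :: real
  assumes "A > 0" "h > 0" "z > 0" "r \<ge> 0"
  shows "has_bochner_integral (lborel \<Otimes>\<^sub>M lborel)
    (\<lambda>(u, \<sigma>). indicator {0<..<1} u * (u powr (A - 1) * (1 - u) powr (h - 1)) * (indicator {0<..} \<sigma> * \<sigma> powr (h - 1)) * exp (- z * (r * u + \<sigma>)))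
    (Gamma h * z powr - h * Beta_integral A h (\<lambda>u. exp (- (r * z) * u)))"
proof (rule has_bochner_integral_lborel_pair_nonneg)
  fix u :: real
  have e: "exp (- z * (r * u + \<sigma>)) = exp (- (r * z) * u) * exp (- z * \<sigma>)" for \<sigma>
    by (simp add: algebra_simps flip: exp_add)
  let ?W = "indicator {0<..<1} u * (u powr (A - 1) * (1 - u) powr (h - 1))"
  have "has_bochner_integral lborel (\<lambda>\<sigma>. ?W * exp (- (r * z) * u) * (indicator {0<..} \<sigma> * (\<sigma> powr (h - 1) * exp (- z * \<sigma>))))
     (?W * exp (- (r * z) * u) * (Gamma h * z powr - h))"
    by (intro has_bochner_integral_mult_right has_bochner_integral_Gamma assms)
  then show "has_bochner_integral lborel
     (\<lambda>\<sigma>. case (u, \<sigma>) of (u, \<sigma>) \<Rightarrow> indicator {0<..<1} u * (u powr (A - 1) * (1 - u) powr (h - 1)) * (indicator {0<..} \<sigma> * \<sigma> powr (h - 1)) * exp (- z * (r * u + \<sigma>)))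
     (Gamma h * z powr - h * (indicator {0<..<1} u * (u powr (A - 1) * (1 - u) powr (h - 1) * exp (- (r * z) * u))))"
    unfolding prod.case e by (simp add: mult_ac)
next
  show "has_bochner_integral lborel (\<lambda>u. Gamma h * z powr - h * (indicator {0<..<1} u * (u powr (A - 1) * (1 - u) powr (h - 1) * exp (- (r * z) * u))))
    (Gamma h * z powr - h * Beta_integral A h (\<lambda>u. exp (- (r * z) * u)))"
    using assms by (intro has_bochner_integral_mult_right has_bochner_integral_Beta_exp) auto
qed (auto split: prod.splits)

subsection \<open>Passage from exponentials to powers of the distance to the sphere\<close>

text \<open>By linearity the hypothesis gives equality for every polynomial in
  \<open>exp (- \<phi> x)\<close>. This quantity lies in the unit interval, where Weierstrass
  approximates \<open>H\<close> uniformly, and the error is at most \<open>e\<close> times the sum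
  of the L1 norms of \<open>D\<close> and \<open>D'\<close>, which may change sign.\<close>

lemma laplace_transfer:
  fixes D :: "'a \<Rightarrow> real" and D' :: "'b \<Rightarrow> real"
  assumes D: "integrable M D" "integrable M' D'"
    and [measurable]: "\<phi> \<in> borel_measurable M" "\<phi>' \<in> borel_measurable M'"
    and nonneg: "\<And>x. \<phi> x \<ge> 0" "\<And>x. \<phi>' x \<ge> 0"
    and eq: "\<And>n :: nat. (\<integral>x. D x * exp (- real n * \<phi> x) \<partial>M) = (\<integral>x. D' x * exp (- real n * \<phi>' x) \<partial>M')"
    and cont: "continuous_on UNIV (H :: real \<Rightarrow> real)"
  shows "integrable M (\<lambda>x. D x * H (exp (- \<phi> x)))" "integrable M' (\<lambda>x. D' x * H (exp (- \<phi>' x)))"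
    "(\<integral>x. D x * H (exp (- \<phi> x)) \<partial>M) = (\<integral>x. D' x * H (exp (- \<phi>' x)) \<partial>M')"
proof -
  have weighted: "integrable N (\<lambda>x. E x * F (exp (- \<psi> x)))"
    if "integrable N E" "\<psi> \<in> borel_measurable N" "\<And>x. \<psi> x \<ge> 0" "continuous_on UNIV F"
    for N :: "'c measure" and E \<psi> and F :: "real \<Rightarrow> real"
  proof -
    note [measurable] = that(2) borel_measurable_continuous_onI[OF that(4)]
    have "bounded (F ` {0..1})"
      using that(4) by (intro compact_imp_bounded compact_continuous_image) (auto intro: continuous_on_subset)
    then obtain B where B: "\<And>X. X \<in> {0..1} \<Longrightarrow> \<bar>F X\<bar> \<le> B" unfolding bounded_iff by (metis imageI real_norm_def)
    show ?thesis
    proof (rule Bochner_Integration.integrable_bound)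
      show "integrable N (\<lambda>x. B * E x)" using that(1) by simp
      show "AE x in N. norm (E x * F (exp (- \<psi> x))) \<le> norm (B * E x)"
      proof (intro AE_I2)
        fix x
        have "\<bar>F (exp (- \<psi> x))\<bar> \<le> \<bar>B\<bar>" using B[of "exp (- \<psi> x)"] that(3)[of x] by auto
        then have "\<bar>E x\<bar> * \<bar>F (exp (- \<psi> x))\<bar> \<le> \<bar>E x\<bar> * \<bar>B\<bar>" by (intro mult_left_mono) auto
        then show "norm (E x * F (exp (- \<psi> x))) \<le> norm (B * E x)" by (simp add: abs_mult mult.commute)
      qed
      show "(\<lambda>x. E x * F (exp (- \<psi> x))) \<in> borel_measurable N" using that(1) by measurable
    qed
  qed
  note wD = weighted[OF D(1) assms(3) nonneg(1)] and wD' = weighted[OF D(2) assms(4) nonneg(2)]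
  show I: "integrable M (\<lambda>x. D x * H (exp (- \<phi> x)))" "integrable M' (\<lambda>x. D' x * H (exp (- \<phi>' x)))"
    by (intro wD wD' cont)+
  have poly_eq: "(\<integral>x. D x * poly p (exp (- \<phi> x)) \<partial>M) = (\<integral>x. D' x * poly p (exp (- \<phi>' x)) \<partial>M')" for p
  proof -
    have expand: "E * poly p (exp (- s)) = (\<Sum>i\<le>degree p. coeff p i * (E * exp (- real i * s)))" for E s :: real
      by (simp add: poly_altdef sum_distrib_left mult_ac flip: exp_of_nat_mult)
    have i: "integrable M (\<lambda>x. D x * exp (- real i * \<phi> x))" "integrable M' (\<lambda>x. D' x * exp (- real i * \<phi>' x))" for i
      using wD[of "\<lambda>X. X ^ i"] wD'[of "\<lambda>X. X ^ i"] by (simp_all add: continuous_intros flip: exp_of_nat_mult)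
    show ?thesis unfolding expand using i eq by simp
  qed
  define S where "S = (\<integral>x. \<bar>D x\<bar> \<partial>M) + (\<integral>x. \<bar>D' x\<bar> \<partial>M')"
  have close: "\<bar>(\<integral>x. E x * H (exp (- \<psi> x)) \<partial>N) - (\<integral>x. E x * poly p (exp (- \<psi> x)) \<partial>N)\<bar> \<le> e * (\<integral>x. \<bar>E x\<bar> \<partial>N)"
    if "\<And>X. X \<in> {0..1} \<Longrightarrow> \<bar>H X - poly p X\<bar> \<le> e" "integrable N E" "\<psi> \<in> borel_measurable N" "\<And>x. \<psi> x \<ge> 0"
    for N :: "'c measure" and E \<psi> p e
  proof -
    have i: "integrable N (\<lambda>x. E x * H (exp (- \<psi> x)))" "integrable N (\<lambda>x. E x * poly p (exp (- \<psi> x)))"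
      using that by (intro weighted cont; auto intro!: continuous_intros)+
    have "\<bar>(\<integral>x. E x * H (exp (- \<psi> x)) \<partial>N) - (\<integral>x. E x * poly p (exp (- \<psi> x)) \<partial>N)\<bar>
       = \<bar>\<integral>x. E x * H (exp (- \<psi> x)) - E x * poly p (exp (- \<psi> x)) \<partial>N\<bar>"
      using i by simp
    also have "\<dots> \<le> (\<integral>x. \<bar>E x * H (exp (- \<psi> x)) - E x * poly p (exp (- \<psi> x))\<bar> \<partial>N)"
      by (rule integral_abs_bound)
    also have "\<dots> \<le> (\<integral>x. e * \<bar>E x\<bar> \<partial>N)"
    proof (rule integral_mono)
      fix x
      have "\<bar>H (exp (- \<psi> x)) - poly p (exp (- \<psi> x))\<bar> \<le> e" using that(1)[of "exp (- \<psi> x)"] that(4)[of x] by auto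
      then have "\<bar>E x\<bar> * \<bar>H (exp (- \<psi> x)) - poly p (exp (- \<psi> x))\<bar> \<le> \<bar>E x\<bar> * e" by (intro mult_left_mono) auto
      then show "\<bar>E x * H (exp (- \<psi> x)) - E x * poly p (exp (- \<psi> x))\<bar> \<le> e * \<bar>E x\<bar>"
        by (simp add: mult.commute flip: right_diff_distrib abs_mult)
    qed (use i that(2) in auto)
    finally show ?thesis by simp
  qed
  let ?d = "\<bar>(\<integral>x. D x * H (exp (- \<phi> x)) \<partial>M) - (\<integral>x. D' x * H (exp (- \<phi>' x)) \<partial>M')\<bar>"
  have d_le: "?d \<le> e * S" if e: "e > 0" for e
  proof -
    have "continuous_on {0..1} H" using cont continuous_on_subset by blast
    then obtain p where p: "real_polynomial_function p" "\<And>X. X \<in> {0..1} \<Longrightarrow> \<bar>H X - p X\<bar> < e"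
      using Stone_Weierstrass_real_polynomial_function[of "{0..1}" H e] e by auto
    obtain q where q: "p = poly q"
    proof -
      obtain a n where "p = (\<lambda>X. \<Sum>i\<le>n. a i * X ^ i)" using real_polynomial_function_imp_sum[OF p(1)] by blast
      then have "p = poly (\<Sum>i\<le>n. monom (a i) i)" by (simp add: fun_eq_iff poly_sum poly_monom)
      then show ?thesis by (rule that)
    qed
    have "\<And>X. X \<in> {0..1} \<Longrightarrow> \<bar>H X - poly q X\<bar> \<le> e" using p(2) q less_imp_le by blast
    from close[OF this D(1) assms(3) nonneg(1)] close[OF this D(2) assms(4) nonneg(2)]
    show ?thesis unfolding poly_eq S_def distrib_left by linarith
  qed
  have S: "S \<ge> 0" by (simp add: S_def)
  have "?d \<le> 0 + e" if "e > 0" for e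
  proof -
    \<comment> \<open>Dividing by \<open>S + 1\<close> rather than \<open>S\<close> covers the case
      \<open>S = 0\<close>.\<close>
    have "?d \<le> e / (S + 1) * S" using d_le[of "e / (S + 1)"] that S by simp
    also have "\<dots> \<le> e" using that S by (simp add: field_simps)
    finally show ?thesis by simp
  qed
  then have "?d \<le> 0" by (rule field_le_epsilon)
  then show "(\<integral>x. D x * H (exp (- \<phi> x)) \<partial>M) = (\<integral>x. D' x * H (exp (- \<phi>' x)) \<partial>M')" by simp
qed

text \<open>The reflection about \<open>x / 2\<close> preserves Lebesgue measure. It exchanges the
  convolution form of \<open>riesz_integrand\<close> with the form having the kernel in
  \<open>x - y\<close>.\<close>

lemma has_bochner_integral_reflect_translate:
  fixes F :: "'a::euclidean_space \<Rightarrow> real"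
  assumes "has_bochner_integral lborel F I"
  shows "has_bochner_integral lborel (\<lambda>y. F (x - y)) I"
proof -
  have eq: "lborel = distr lborel borel (\<lambda>y :: 'a. x - y)"
    using lborel_affine[of "-1" x] by (simp add: density_1 one_ennreal_def[symmetric])
  have [measurable]: "F \<in> borel_measurable borel"
    using borel_measurable_has_bochner_integral[OF assms] by simp
  have "has_bochner_integral (distr lborel borel (\<lambda>y :: 'a. x - y)) F I"
    using assms eq by simp
  then show ?thesis
    by (simp add: has_bochner_integral_iff integrable_distr_eq integral_distr)
qed

text \<open>For \<open>c < 1\<close> the weight \<open>(1 - \<rho>) powr (c - 1)\<close> blows up at
  the sphere and cannot enter \<open>laplace_transfer\<close>. These functions are continuous for
  \<open>c > 0\<close>, vanish for \<open>\<rho> \<ge> 1\<close>, and increase with \<open>j\<close>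
  to \<open>cutoff_lim c \<rho>\<close>.\<close>

definition cutoff :: "real \<Rightarrow> nat \<Rightarrow> real \<Rightarrow> real" where
  "cutoff c j \<rho> = max 0 (1 - \<rho>) powr c / (max 0 (1 - \<rho>) + 1 / (real j + 1))"

definition cutoff_lim :: "real \<Rightarrow> real \<Rightarrow> real" where
  "cutoff_lim c \<rho> = (if \<rho> < 1 then (1 - \<rho>) powr (c - 1) else 0)"

lemma cutoff_nonneg: "cutoff c j \<rho> \<ge> 0"
  by (simp add: cutoff_def)

lemma cutoff_eq_0: "\<rho> \<ge> 1 \<Longrightarrow> cutoff c j \<rho> = 0"
  by (simp add: cutoff_def)

lemma continuous_on_cutoff:
  assumes "c > 0"
  shows "continuous_on S (cutoff c j)"
  unfolding cutoff_def
  by (intro continuous_intros continuous_on_powr') (use assms in \<open>auto simp: add_nonneg_eq_0_iff\<close>)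

lemma cutoff_le: "cutoff c j \<rho> \<le> cutoff_lim c \<rho>"
proof (cases "\<rho> < 1")
  case True
  then have "cutoff c j \<rho> \<le> (1 - \<rho>) powr c / (1 - \<rho>)"
    unfolding cutoff_def by (auto intro!: divide_left_mono mult_pos_pos add_pos_nonneg)
  also have "\<dots> = cutoff_lim c \<rho>" using True by (simp add: cutoff_lim_def powr_diff)
  finally show ?thesis .
qed (simp add: cutoff_eq_0 cutoff_lim_def)

lemma mono_cutoff: "mono (\<lambda>j. cutoff c j \<rho>)"
proof (rule monoI)
  fix i j :: nat assume "i \<le> j"
  then show "cutoff c i \<rho> \<le> cutoff c j \<rho>"
    unfolding cutoff_def by (intro divide_left_mono mult_pos_pos add_nonneg_pos add_left_mono) (auto intro: frac_le)
qed

lemma cutoff_tendsto: "(\<lambda>j. cutoff c j \<rho>) \<longlonglongrightarrow> cutoff_lim c \<rho>"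
proof (cases "\<rho> < 1")
  case True
  have "(\<lambda>j. 1 / (real j + 1)) \<longlonglongrightarrow> 0"
    using LIMSEQ_inverse_real_of_nat by (simp add: inverse_eq_divide add.commute)
  then have "(\<lambda>j. (1 - \<rho>) powr c / ((1 - \<rho>) + 1 / (real j + 1))) \<longlonglongrightarrow> (1 - \<rho>) powr c / ((1 - \<rho>) + 0)"
    using True by (intro tendsto_intros) auto
  then show ?thesis using True by (simp add: cutoff_def cutoff_lim_def powr_diff)
qed (simp add: cutoff_eq_0 cutoff_lim_def)

lemma borel_measurable_cutoff_lim [measurable]: "cutoff_lim c \<in> borel_measurable borel"
  unfolding cutoff_lim_def by measurable

section \<open>The double integral over u and \<sigma>\<close>

definition pair_weight :: "real \<Rightarrow> real \<Rightarrow> real \<times> real \<Rightarrow> real" where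
  "pair_weight A h = (\<lambda>(u, \<sigma>). indicator {0<..<1} u * (u powr (A - 1) * (1 - u) powr (h - 1)) * (indicator {0<..} \<sigma> * \<sigma> powr (h - 1)))"

lemma pair_weight_nonneg: "pair_weight A h p \<ge> 0"
  by (auto simp: pair_weight_def split: prod.splits)

lemma borel_measurable_pair_weight [measurable]:
  "pair_weight A h \<in> borel_measurable (lborel \<Otimes>\<^sub>M lborel)"
  unfolding pair_weight_def by measurable

text \<open>\<open>laplace_transfer\<close> demands a phase that is nonnegative everywhere, whereas
  \<open>r * u + \<sigma>\<close> is so only on the support of the weight; there the absolute value
  changes nothing.\<close>

lemma pair_weight_abs:
  assumes "r \<ge> 0"
  shows "pair_weight A h p * g \<bar>r * fst p + snd p\<bar> = pair_weight A h p * g (r * fst p + snd p)"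
  using assms by (auto simp: pair_weight_def indicator_def split: prod.splits)

lemma has_bochner_integral_pair_weight_cutoff_lim:
  assumes "A > 0" "h > 0" "c > 0" "0 \<le> r" "r < 1"
  shows "has_bochner_integral (lborel \<Otimes>\<^sub>M lborel) (\<lambda>p. pair_weight A h p * cutoff_lim c (r * fst p + snd p))
    (Beta h c * Beta_integral A h (\<lambda>u. (1 - r * u) powr (h + c - 1)))"
proof (rule has_bochner_integral_lborel_pair_nonneg)
  have ru: "r * u < 1" "r * u \<le> r" if "0 < u" "u < 1" for u
    using that assms mult_left_mono[of u 1 r] by auto
  show "has_bochner_integral lborel (\<lambda>\<sigma>. pair_weight A h (u, \<sigma>) * cutoff_lim c (r * fst (u, \<sigma>) + snd (u, \<sigma>)))
     (Beta h c * (indicator {0<..<1} u * (u powr (A - 1) * (1 - u) powr (h - 1) * (1 - r * u) powr (h + c - 1))))" for u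
  proof (cases "0 < u \<and> u < 1")
    case True
    let ?W = "u powr (A - 1) * (1 - u) powr (h - 1)"
    have "has_bochner_integral lborel (\<lambda>\<sigma>. ?W * (indicator {0<..} \<sigma> * \<sigma> powr (h - 1) * (if r * u + \<sigma> < 1 then (1 - (r * u + \<sigma>)) powr (c - 1) else 0)))
       (?W * (Beta h c * (1 - r * u) powr (h + c - 1)))"
      using True by (intro has_bochner_integral_mult_right has_bochner_integral_Beta_shifted assms ru) auto
    then show ?thesis using True by (simp add: pair_weight_def cutoff_lim_def mult_ac)
  qed (auto simp: pair_weight_def indicator_def intro: has_bochner_integral_zero)
  \<comment> \<open>The exponent may have either sign; the base lies between the positive number
    \<open>1 - r\<close> and 1.\<close>
  have "\<bar>(1 - r * u) powr (h + c - 1)\<bar> \<le> max 1 ((1 - r) powr (h + c - 1))" if "0 < u" "u < 1" for u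
  proof (cases "h + c - 1 \<ge> 0")
    case True
    have "(1 - r * u) powr (h + c - 1) \<le> 1"
      using True ru[OF that] assms that by (intro powr_le1) auto
    then show ?thesis by simp
  next
    case False
    have "(1 - r * u) powr (h + c - 1) \<le> (1 - r) powr (h + c - 1)"
      using False ru[OF that] assms by (intro powr_mono2') auto
    then show ?thesis by simp
  qed
  then have "integrable lborel (\<lambda>u. indicator {0<..<1} u * (u powr (A - 1) * (1 - u) powr (h - 1) * (1 - r * u) powr (h + c - 1)))"
    using assms by (intro integrable_Beta_weight) auto
  then show "has_bochner_integral lborel (\<lambda>u. Beta h c * (indicator {0<..<1} u * (u powr (A - 1) * (1 - u) powr (h - 1) * (1 - r * u) powr (h + c - 1))))
     (Beta h c * Beta_integral A h (\<lambda>u. (1 - r * u) powr (h + c - 1)))"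
    by (intro has_bochner_integral_mult_right) (simp add: has_bochner_integral_iff)
qed (auto simp: pair_weight_nonneg cutoff_lim_def)

text \<open>Both sides are linear in \<open>g\<close> and agree on exponentials, so
  \<open>laplace_transfer\<close> extends the identity to continuous \<open>g\<close> vanishing
  beyond 1.\<close>

lemma riesz_integral_transfer:
  fixes V :: "real ^ 'd \<Rightarrow> real" and x :: "real ^ 'd" and g :: "real \<Rightarrow> real" and b h :: real
  assumes V: "solid_harmonic l V" and b: "b > 0" and h: "h > 0" and bh: "b + h = CARD('d) / 2"
    and g: "continuous_on UNIV g" "\<And>\<rho>. \<rho> \<ge> 1 \<Longrightarrow> g \<rho> = 0"
  defines "K \<equiv> V x * (pi powr (CARD('d) / 2) / (Gamma b * Gamma h))"
  shows "integrable lborel (\<lambda>y. V y * norm (x - y) powr (- 2 * b) * g ((norm y)\<^sup>2))"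
    "(\<integral>y. V y * norm (x - y) powr (- 2 * b) * g ((norm y)\<^sup>2) \<partial>lborel)
      = K * (\<integral>p. pair_weight (b + l) h p * g ((norm x)\<^sup>2 * fst p + snd p) \<partial>(lborel \<Otimes>\<^sub>M lborel))"
proof -
  define r where "r = (norm x)\<^sup>2"
  have r: "r \<ge> 0" by (simp add: r_def)
  define A where "A = b + l"
  have A: "A > 0" using b by (simp add: A_def)
  \<comment> \<open>One factor \<open>exp (- \<rho>)\<close> is moved into \<open>D\<close> and
    \<open>D'\<close> to make them integrable; the remaining exponentials have rates
    \<open>n \<ge> 0\<close>, total rate \<open>n + 1\<close>.\<close>
  define D where "D y = exp (- (norm y)\<^sup>2) * V y * norm (x - y) powr (- 2 * b)" for y
  define \<phi>' where "\<phi>' p = \<bar>r * fst p + snd p\<bar>" for p :: "real \<times> real"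
  define D' where "D' p = K * (pair_weight A h p * exp (- \<phi>' p))" for p
  \<comment> \<open>Restores the factor moved into \<open>D\<close>, with
    \<open>\<rho> = - ln X\<close>. Truncating at \<open>exp (- 1)\<close> keeps \<open>H\<close>
    continuous at 0 and is correct because \<open>g\<close> vanishes from 1 onward.\<close>
  define H where "H X = g (- ln (max X (exp (- 1)))) / max X (exp (- 1))" for X :: real
  have HX: "exp (- \<rho>) * H (exp (- \<rho>)) = g \<rho>" if "\<rho> \<ge> 0" for \<rho>
    using g(2)[of \<rho>] g(2)[of 1] by (cases "\<rho> \<le> 1") (auto simp: H_def max_def)
  have L: "has_bochner_integral lborel (\<lambda>y. D y * exp (- real n * (norm y)\<^sup>2))
      (K * (Gamma h * (real n + 1) powr - h * Beta_integral A h (\<lambda>u. exp (- (r * (real n + 1)) * u))))" for n :: nat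
  proof -
    have "exp (- (norm y)\<^sup>2) * exp (- real n * (norm y)\<^sup>2) = exp (- (real n + 1) * (norm y)\<^sup>2)" for y :: "real ^ 'd"
      by (simp add: algebra_simps flip: exp_add)
    moreover have "D y * exp (- real n * (norm y)\<^sup>2) = (exp (- (norm y)\<^sup>2) * exp (- real n * (norm y)\<^sup>2)) * V y * norm (x - y) powr (- 2 * b)" for y
      unfolding D_def by (simp add: mult_ac)
    ultimately have "D y * exp (- real n * (norm y)\<^sup>2) = exp (- (real n + 1) * (norm y)\<^sup>2) * V y * norm (x - y) powr (- 2 * b)" for y
      by (simp only:)
    moreover have "Gamma h > 0" by (rule Gamma_real_pos[OF h])
    ultimately show ?thesis
      using has_bochner_integral_riesz_gauss[OF V b h bh, of "real n + 1" x]
      by (simp add: K_def A_def r_def mult_ac)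
  qed
  have R: "has_bochner_integral (lborel \<Otimes>\<^sub>M lborel) (\<lambda>p. D' p * exp (- real n * \<phi>' p))
      (K * (Gamma h * (real n + 1) powr - h * Beta_integral A h (\<lambda>u. exp (- (r * (real n + 1)) * u))))" for n :: nat
  proof -
    have "D' p * exp (- real n * \<phi>' p) = K * (case p of (u, \<sigma>) \<Rightarrow> indicator {0<..<1} u * (u powr (A - 1) * (1 - u) powr (h - 1)) * (indicator {0<..} \<sigma> * \<sigma> powr (h - 1)) * exp (- (real n + 1) * (r * u + \<sigma>)))" for p
    proof -
      have "D' p * exp (- real n * \<phi>' p) = K * (pair_weight A h p * (\<lambda>\<rho>. exp (- (real n + 1) * \<rho>)) (\<phi>' p))"
        unfolding D'_def by (simp add: algebra_simps flip: exp_add)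
      also have "\<dots> = K * (pair_weight A h p * (\<lambda>\<rho>. exp (- (real n + 1) * \<rho>)) (r * fst p + snd p))"
        unfolding \<phi>'_def by (simp only: pair_weight_abs[OF r, of A h p "\<lambda>\<rho>. exp (- (real n + 1) * \<rho>)"])
      finally show ?thesis by (simp add: pair_weight_def split: prod.splits)
    qed
    then show ?thesis
      using has_bochner_integral_mult_right[OF has_bochner_integral_exp_pair[OF A h _ r, of "real n + 1"], of K] by simp
  qed
  have D: "integrable lborel D" "integrable (lborel \<Otimes>\<^sub>M lborel) D'"
    using L[of 0] R[of 0] by (simp_all add: has_bochner_integral_iff)
  have m: "(\<lambda>y :: real ^ 'd. (norm y)\<^sup>2) \<in> borel_measurable lborel" "\<phi>' \<in> borel_measurable (lborel \<Otimes>\<^sub>M lborel)"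
    unfolding \<phi>'_def by measurable
  have cont: "continuous_on UNIV H"
  proof -
    have "continuous_on UNIV (\<lambda>X :: real. - ln (max X (exp (- 1))))"
      by (intro continuous_intros) (auto simp: max_def not_le intro: less_le_trans[OF exp_gt_zero] dest: less_le_trans[OF exp_gt_zero])
    then have "continuous_on UNIV (\<lambda>X :: real. g (- ln (max X (exp (- 1)))))"
      by (rule continuous_on_compose2[OF g(1)]) auto
    moreover have "max X (exp (- 1)) \<noteq> (0 :: real)" for X
      by (metis exp_gt_zero less_max_iff_disj less_irrefl)
    ultimately show ?thesis unfolding H_def by (intro continuous_intros) auto
  qed
  have eq: "(\<integral>y. D y * exp (- real n * (norm y)\<^sup>2) \<partial>lborel) = (\<integral>p. D' p * exp (- real n * \<phi>' p) \<partial>(lborel \<Otimes>\<^sub>M lborel))" for n :: nat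
    using L[of n] R[of n] by (simp only: has_bochner_integral_iff)
  have eD: "D y * H (exp (- (norm y)\<^sup>2)) = V y * norm (x - y) powr (- 2 * b) * g ((norm y)\<^sup>2)" for y
    using HX[of "(norm y)\<^sup>2"] by (simp add: D_def mult_ac)
  have eD': "D' p * H (exp (- \<phi>' p)) = K * (pair_weight (b + l) h p * g ((norm x)\<^sup>2 * fst p + snd p))" for p
  proof -
    have "D' p * H (exp (- \<phi>' p)) = K * (pair_weight A h p * g (\<phi>' p))"
      using HX[of "\<phi>' p"] by (simp add: D'_def \<phi>'_def mult_ac)
    also have "\<dots> = K * (pair_weight A h p * g (r * fst p + snd p))"
      unfolding \<phi>'_def by (simp only: pair_weight_abs[OF r, of A h p g])
    finally show ?thesis by (simp add: A_def r_def)
  qed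
  note T = laplace_transfer[OF D m _ _ eq cont, unfolded eD eD']
  show "integrable lborel (\<lambda>y. V y * norm (x - y) powr (- 2 * b) * g ((norm y)\<^sup>2))"
    by (rule T(1)) (auto simp: \<phi>'_def)
  show "(\<integral>y. V y * norm (x - y) powr (- 2 * b) * g ((norm y)\<^sup>2) \<partial>lborel)
      = K * (\<integral>p. pair_weight (b + l) h p * g ((norm x)\<^sup>2 * fst p + snd p) \<partial>(lborel \<Otimes>\<^sub>M lborel))"
    using T(3) by (simp add: \<phi>'_def)
qed

text \<open>The identity for \<open>cutoff\<close> passes to the limit in two stages. For the
  constant polynomial, monotone convergence gives integrability of kernel times weight. Since
  \<open>V\<close> is bounded on the ball, a multiple of that function dominates the general
  case.\<close>

lemma has_bochner_integral_riesz_ball_weight: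
  fixes V :: "real ^ 'd \<Rightarrow> real" and x :: "real ^ 'd" and b h \<gamma> :: real
  assumes V: "solid_harmonic l V" and b: "b > 0" and h: "h > 0" and bh: "b + h = CARD('d) / 2"
    and \<gamma>: "\<gamma> > -1" and x: "norm x < 1"
  shows "has_bochner_integral lborel (\<lambda>y. ball_weight \<gamma> y * V y * norm (x - y) powr (- 2 * b))
    (V x * (pi powr (CARD('d) / 2) / (Gamma b * Gamma h)) *
      (Beta h (\<gamma> + 1) * Beta_integral (b + l) h (\<lambda>u. (1 - (norm x)\<^sup>2 * u) powr (h + \<gamma>))))"
proof -
  define c where "c = \<gamma> + 1"
  have c: "c > 0" using \<gamma> by (simp add: c_def)
  note [measurable] = borel_measurable_continuous_onI[OF continuous_on_solid_harmonic[OF V]]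
    borel_measurable_continuous_onI[OF continuous_on_cutoff[OF c]]
  have bw: "ball_weight \<gamma> y = cutoff_lim c ((norm y)\<^sup>2)" for y :: "real ^ 'd"
    by (auto simp: ball_weight_def cutoff_lim_def c_def abs_square_less_1)
  define r where "r = (norm x)\<^sup>2"
  have r: "0 \<le> r" "r < 1" using x by (auto simp: r_def abs_square_less_1)
  define \<kappa> where "\<kappa> y = norm (x - y) powr (- 2 * b)" for y
  define C where "C = pi powr (CARD('d) / 2) / (Gamma b * Gamma h)"
  define R where "R k = Beta h c * Beta_integral (b + real k) h (\<lambda>u. (1 - r * u) powr (h + c - 1))" for k :: nat
  \<comment> \<open>Stated for arbitrary \<open>U\<close> of degree \<open>k\<close>, as it is
    needed for the constant 1 as well as for \<open>V\<close>.\<close>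
  have lim: "(\<lambda>j. \<integral>y. U y * \<kappa> y * cutoff c j ((norm y)\<^sup>2) \<partial>lborel) \<longlonglongrightarrow> U x * C * R k"
    if U: "solid_harmonic k U" for U k
  proof -
    have R: "has_bochner_integral (lborel \<Otimes>\<^sub>M lborel) (\<lambda>p. pair_weight (b + k) h p * cutoff_lim c (r * fst p + snd p)) (R k)"
      unfolding R_def using b h c r by (intro has_bochner_integral_pair_weight_cutoff_lim) auto
    have "(\<lambda>j. \<integral>p. pair_weight (b + k) h p * cutoff c j (r * fst p + snd p) \<partial>(lborel \<Otimes>\<^sub>M lborel))
       \<longlonglongrightarrow> (\<integral>p. pair_weight (b + k) h p * cutoff_lim c (r * fst p + snd p) \<partial>(lborel \<Otimes>\<^sub>M lborel))"
    proof (rule integral_dominated_convergence)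
      show "integrable (lborel \<Otimes>\<^sub>M lborel) (\<lambda>p. pair_weight (b + k) h p * cutoff_lim c (r * fst p + snd p))"
        using R by (simp add: has_bochner_integral_iff)
      show "AE p in lborel \<Otimes>\<^sub>M lborel. (\<lambda>j. pair_weight (b + k) h p * cutoff c j (r * fst p + snd p))
          \<longlonglongrightarrow> pair_weight (b + k) h p * cutoff_lim c (r * fst p + snd p)"
        by (intro AE_I2 tendsto_mult_left cutoff_tendsto)
      show "AE p in lborel \<Otimes>\<^sub>M lborel. norm (pair_weight (b + k) h p * cutoff c j (r * fst p + snd p))
         \<le> pair_weight (b + k) h p * cutoff_lim c (r * fst p + snd p)" for j
        by (intro AE_I2) (simp add: abs_mult pair_weight_nonneg cutoff_nonneg mult_left_mono cutoff_le)
    qed measurable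
    then have "(\<lambda>j. U x * C * (\<integral>p. pair_weight (b + k) h p * cutoff c j (r * fst p + snd p) \<partial>(lborel \<Otimes>\<^sub>M lborel)))
       \<longlonglongrightarrow> U x * C * R k"
      using R by (intro tendsto_mult_left) (simp add: has_bochner_integral_iff)
    then show ?thesis
      unfolding r_def \<kappa>_def C_def
      by (subst riesz_integral_transfer(2)[OF U b h bh continuous_on_cutoff[OF c] cutoff_eq_0])
  qed
  have int: "integrable lborel (\<lambda>y. U y * \<kappa> y * cutoff c j ((norm y)\<^sup>2))" if U: "solid_harmonic k U" for U k j
    unfolding \<kappa>_def by (rule riesz_integral_transfer(1)[OF U b h bh continuous_on_cutoff[OF c] cutoff_eq_0])
  have I1: "integrable lborel (\<lambda>y. \<kappa> y * cutoff_lim c ((norm y)\<^sup>2))"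
  proof (rule integrable_monotone_convergence)
    show "integrable lborel (\<lambda>y. \<kappa> y * cutoff c j ((norm y)\<^sup>2))" for j
      using int[OF solid_harmonic_one] by simp
    show "AE y in lborel. mono (\<lambda>j. \<kappa> y * cutoff c j ((norm y)\<^sup>2))"
      using mono_cutoff by (auto simp: mono_def \<kappa>_def intro!: mult_left_mono)
    show "AE y in lborel. (\<lambda>j. \<kappa> y * cutoff c j ((norm y)\<^sup>2)) \<longlonglongrightarrow> \<kappa> y * cutoff_lim c ((norm y)\<^sup>2)"
      by (intro AE_I2 tendsto_mult_left cutoff_tendsto)
    show "(\<lambda>j. \<integral>y. \<kappa> y * cutoff c j ((norm y)\<^sup>2) \<partial>lborel) \<longlonglongrightarrow> C * R 0"
      using lim[OF solid_harmonic_one] by simp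
    show "(\<lambda>y. \<kappa> y * cutoff_lim c ((norm y)\<^sup>2)) \<in> borel_measurable lborel"
      unfolding \<kappa>_def by measurable
  qed
  obtain M where M: "M \<ge> 0" "\<And>y. \<bar>V y\<bar> \<le> M * norm y ^ l" using solid_harmonic_norm_bound[OF V] by blast
  have bound: "norm (V y * \<kappa> y * cutoff c j ((norm y)\<^sup>2)) \<le> M * (\<kappa> y * cutoff_lim c ((norm y)\<^sup>2))" for y j
  proof (cases "norm y < 1")
    case True
    then have "norm y ^ l \<le> 1" by (simp add: power_le_one)
    then have "\<bar>V y\<bar> \<le> M" using M(1) M(2)[of y] mult_left_mono[of "norm y ^ l" 1 M] by simp
    then have "\<bar>V y\<bar> * (\<kappa> y * cutoff c j ((norm y)\<^sup>2)) \<le> M * (\<kappa> y * cutoff_lim c ((norm y)\<^sup>2))"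
      using M(1) by (intro mult_mono cutoff_le) (auto simp: \<kappa>_def cutoff_nonneg)
    then show ?thesis by (simp add: abs_mult \<kappa>_def cutoff_nonneg mult_ac)
  next
    case False
    then have "(norm y)\<^sup>2 \<ge> 1" by simp
    then show ?thesis by (simp add: cutoff_eq_0 cutoff_lim_def)
  qed
  have dom: "integrable lborel (\<lambda>y. M * (\<kappa> y * cutoff_lim c ((norm y)\<^sup>2)))" using I1 by simp
  have pw: "AE y in lborel. (\<lambda>j. V y * \<kappa> y * cutoff c j ((norm y)\<^sup>2)) \<longlonglongrightarrow> V y * \<kappa> y * cutoff_lim c ((norm y)\<^sup>2)"
    by (intro AE_I2 tendsto_mult_left cutoff_tendsto)
  have m: "(\<lambda>y. V y * \<kappa> y * cutoff_lim c ((norm y)\<^sup>2)) \<in> borel_measurable lborel"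
    "\<And>j. (\<lambda>y. V y * \<kappa> y * cutoff c j ((norm y)\<^sup>2)) \<in> borel_measurable lborel"
    unfolding \<kappa>_def by measurable
  note dc = m dom pw AE_I2[OF bound]
  have "integrable lborel (\<lambda>y. V y * \<kappa> y * cutoff_lim c ((norm y)\<^sup>2))"
    by (rule integrable_dominated_convergence[OF dc])
  moreover have "(\<integral>y. V y * \<kappa> y * cutoff_lim c ((norm y)\<^sup>2) \<partial>lborel) = V x * C * R l"
    using LIMSEQ_unique[OF integral_dominated_convergence[OF dc] lim[OF V]] .
  ultimately show ?thesis
    unfolding bw has_bochner_integral_iff by (simp add: \<kappa>_def C_def R_def r_def c_def mult_ac)
qed

lemma Beta_integral_power:
  fixes A h r :: real
  assumes "A > 0" "h > 0" "0 \<le> r" "r < 1"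
  shows "Beta_integral A h (\<lambda>u. (1 - r * u) powr real K)
    = (\<Sum>i\<le>K. real (K choose i) * (- r) ^ i * Beta (A + real i) h)"
proof -
  have "indicator {0<..<1} u * (u powr (A - 1) * (1 - u) powr (h - 1) * (1 - r * u) powr real K)
      = (\<Sum>i\<le>K. real (K choose i) * (- r) ^ i * (indicator {0<..<1} u * (u powr (A + real i - 1) * (1 - u) powr (h - 1))))" for u :: real
  proof (cases "0 < u \<and> u < 1")
    case True
    then have "r * u < 1" using assms mult_left_mono[of u 1 r] by auto
    then have "(1 - r * u) powr real K = (- r * u + 1) ^ K" by (simp add: powr_realpow)
    also have "\<dots> = (\<Sum>i\<le>K. real (K choose i) * (- r) ^ i * u ^ i)"
      unfolding binomial_ring power_mult_distrib by (simp add: mult_ac)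
    finally have 1: "(1 - r * u) powr real K = (\<Sum>i\<le>K. real (K choose i) * (- r) ^ i * u ^ i)" .
    have 2: "u powr (A + real i - 1) = u powr (A - 1) * u ^ i" for i
      using True powr_add[of u "A - 1" "real i"] by (simp add: powr_realpow add_diff_eq diff_add_eq)
    show ?thesis unfolding 1 2 using True by (simp add: sum_distrib_left mult_ac)
  qed (auto simp: indicator_def)
  moreover have "has_bochner_integral lborel (\<lambda>u. \<Sum>i\<le>K. real (K choose i) * (- r) ^ i * (indicator {0<..<1} u * (u powr (A + real i - 1) * (1 - u) powr (h - 1))))
     (\<Sum>i\<le>K. real (K choose i) * (- r) ^ i * Beta (A + real i) h)"
    using assms by (intro has_bochner_integral_sum has_bochner_integral_mult_right has_bochner_integral_Beta) auto
  ultimately show ?thesis by (simp add: has_bochner_integral_iff)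
qed

subsection \<open>The Riesz potential of Jacobi polynomials on the ball\<close>

theorem theorem2p1:
  fixes \<alpha> \<delta> :: real and l n :: nat and s :: int
    and V f :: "real ^ 'd \<Rightarrow> real"
  assumes "0 < \<alpha>" and "\<alpha> < 2"
    and "2 - \<alpha> < real CARD('d)"
    and "\<delta> = real CARD('d) + 2 * real l"
    and "\<alpha> / 2 - of_int s > - 1"
    and "solid_harmonic l V"
    and "f = (\<lambda>x. ball_weight (\<alpha> / 2 - of_int s) x * V x
                   * jacobi_poly n (\<alpha> / 2 - of_int s) (\<delta> / 2 - 1) (2 * (norm x)\<^sup>2 - 1))"
  shows "\<forall>x. norm x < 1 \<longrightarrow>
           integrable lborel (riesz_integrand (2 - \<alpha>) f x) \<and>
           riesz_potential (2 - \<alpha>) f x =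
             (- 1) powi (1 - s) * 2 powr (\<alpha> - 2)
             * (Gamma (real n + 1 - of_int s + \<alpha> / 2) * Gamma (real n - 1 + (\<delta> + \<alpha>) / 2))
             / (Gamma (real n + 1) * Gamma (real n + 1 - of_int s + \<delta> / 2))
             * V x
             * jacobi_poly (nat (int n + 1 - s)) (\<alpha> / 2 - 2 + of_int s) (\<delta> / 2 - 1)
                 (2 * (norm x)\<^sup>2 - 1)"
proof (intro allI impI)
  fix x :: "real ^ 'd"
  assume x: "norm x < 1"
  define k where "k = nat (1 - s)"
  \<comment> \<open>The exponent condition and \<open>\<alpha> < 2\<close> force
    \<open>s \<le> 1\<close>, so \<open>1 - s\<close> is the natural number
    \<open>k\<close>.\<close>
  have "real_of_int s < 2" using assms(2,5) by linarith
  then have s: "s = 1 - int k" by (simp add: k_def)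
  define h where "h = 1 - \<alpha> / 2"
  define b where "b = (real CARD('d) - (2 - \<alpha>)) / 2"
  define A where "A = b + real l"
  define N where "N = \<delta> / 2"
  define r where "r = (norm x)\<^sup>2"
  have h: "h > 0" and b: "b > 0" and A: "A > 0" and bh: "b + h = CARD('d) / 2" and N: "N = A + h"
    using assms(2,3,4) by (auto simp: h_def b_def A_def N_def field_simps)
  have r: "0 \<le> r" "r < 1" using x by (auto simp: r_def abs_square_less_1)
  have N0: "N > 0" using N A h by simp
  have \<gamma>: "\<alpha> / 2 - of_int s = real k - h" by (simp add: s h_def)
  have k_h: "real k - h > -1" using assms(5) unfolding \<gamma> .
  define c where "c m = (-1) ^ m / fact n * real (n choose m) * pochhammer (real k - h + N + real n) m
      * pochhammer (real k - h + real m + 1) (n - m)" for m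
  define Q where "Q m = Gamma (real k - h + real m + 1) / fact (k + m)
      * (\<Sum>i\<le>k + m. real ((k + m) choose i) * (- r) ^ i * Gamma (A + real i) / Gamma (N + real i))" for m
  define P where "P = pi powr (CARD('d) / 2)"
  have f: "f y = (\<Sum>m\<le>n. c m * (ball_weight (real k - h + real m) y * V y))" for y
  proof -
    have "f y = ball_weight (real k - h) y * V y * jacobi_poly n (real k - h) (N - 1) (2 * (norm y)\<^sup>2 - 1)"
      by (simp add: assms(7) \<gamma> N_def)
    also have "jacobi_poly n (real k - h) (N - 1) (2 * (norm y)\<^sup>2 - 1) = (\<Sum>m\<le>n. c m * (1 - (norm y)\<^sup>2) ^ m)"
      using N0 by (subst jacobi_poly_one_minus_basis) (simp_all add: c_def algebra_simps)
    also have "ball_weight (real k - h) y * V y * \<dots> = (\<Sum>m\<le>n. c m * (ball_weight (real k - h + real m) y * V y))"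
    proof -
      have "ball_weight (real k - h + real m) y = ball_weight (real k - h) y * (1 - (norm y)\<^sup>2) ^ m" for m
        by (auto simp: ball_weight_def powr_add powr_realpow abs_square_less_1)
      then show ?thesis by (simp add: sum_distrib_left mult_ac)
    qed
    finally show ?thesis .
  qed
  \<comment> \<open>With exponent \<open>k - h + m\<close>, adding \<open>h\<close> gives the
    integer \<open>k + m\<close>; the remaining Beta integral is that of a polynomial and splits
    into finitely many Beta values.\<close>
  have summand: "has_bochner_integral lborel (\<lambda>y. ball_weight (real k - h + real m) y * V y * norm (x - y) powr (- 2 * b))
      (V x * P * Gamma h / Gamma b * Q m)" for m
  proof -
    have km: "h + (real k - h + real m) = real (k + m)" by simp
    have B1: "Beta h (real k - h + real m + 1) = Gamma h * Gamma (real k - h + real m + 1) / fact (k + m)"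
      using Gamma_fact[of "k + m", where 'a = real] by (simp add: Beta_def add_ac)
    have B2: "Beta (A + real i) h = Gamma h * (Gamma (A + real i) / Gamma (N + real i))" for i
      by (simp add: Beta_def N add_ac)
    have "Beta_integral (b + l) h (\<lambda>u. (1 - (norm x)\<^sup>2 * u) powr (h + (real k - h + real m)))
       = Gamma h * (\<Sum>i\<le>k + m. real ((k + m) choose i) * (- r) ^ i * Gamma (A + real i) / Gamma (N + real i))"
      unfolding km A_def[symmetric] r_def[symmetric] Beta_integral_power[OF A h r] B2
      by (simp add: sum_distrib_left mult_ac)
    moreover have "Gamma h > 0" "Gamma b > 0" using h b by (auto intro: Gamma_real_pos)
    moreover have "real k - h + real m > -1" using k_h by simp
    ultimately show ?thesis
      using has_bochner_integral_riesz_ball_weight[OF assms(6) b h bh _ x, of "real k - h + real m"]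
      by (simp add: B1 Q_def P_def mult_ac)
  qed
  have "has_bochner_integral lborel (\<lambda>y. \<Sum>m\<le>n. c m * (ball_weight (real k - h + real m) y * V y * norm (x - y) powr (- 2 * b)))
      (\<Sum>m\<le>n. c m * (V x * P * Gamma h / Gamma b * Q m))"
    by (intro has_bochner_integral_sum has_bochner_integral_mult_right summand)
  then have *: "has_bochner_integral lborel (\<lambda>y. f y * norm (x - y) powr (- 2 * b)) (V x * P * Gamma h / Gamma b * (\<Sum>m\<le>n. c m * Q m))"
    by (simp add: f sum_distrib_left sum_distrib_right sum_divide_distrib mult_ac)
  have main: "has_bochner_integral lborel (riesz_integrand (2 - \<alpha>) f x) (V x * P * Gamma h / Gamma b * (\<Sum>m\<le>n. c m * Q m))"
  proof -
    have e: "- 2 * b = - (real CARD('d) - (2 - \<alpha>))" by (simp add: b_def)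
    have "riesz_integrand (2 - \<alpha>) f x = (\<lambda>y. f (x - y) * norm (x - (x - y)) powr (- 2 * b))"
      unfolding e powr_minus_divide riesz_integrand_def by simp
    then show ?thesis
      using has_bochner_integral_reflect_translate[OF *, of x] by (simp only:)
  qed
  have sum: "(\<Sum>m\<le>n. c m * Q m) = (-1) ^ k * Gamma (real n + real k + 1 - h) * Gamma (real n + A) / (fact n * Gamma (real n + real k + N))
        * jacobi_poly (n + k) (- real k - h) (N - 1) (2 * r - 1)"
    unfolding c_def Q_def by (rule jacobi_coefficient_sum[OF A h N k_h])
  have pos: "Gamma h > 0" "Gamma b > 0" "P > 0" using h b by (auto simp: P_def intro: Gamma_real_pos)
  have "riesz_const CARD('d) (2 - \<alpha>) = 2 powr (2 - \<alpha>) * P * Gamma h / Gamma b"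
    by (simp add: riesz_const_def P_def h_def b_def diff_divide_distrib)
  \<comment> \<open>The normalisation cancels \<open>P * Gamma h / Gamma b\<close> and leaves only
    the power of 2.\<close>
  then have const: "1 / riesz_const CARD('d) (2 - \<alpha>) * (V x * P * Gamma h / Gamma b * S) = 2 powr (\<alpha> - 2) * V x * S" for S
    using pos powr_minus[of 2 "2 - \<alpha>"] by (simp add: field_simps)
  have "riesz_potential (2 - \<alpha>) f x = 2 powr (\<alpha> - 2) * V x * (\<Sum>m\<le>n. c m * Q m)"
    unfolding riesz_potential_def has_bochner_integral_integral_eq[OF main] by (rule const)
  also have "\<dots> = (- 1) powi (1 - s) * 2 powr (\<alpha> - 2)
             * (Gamma (real n + 1 - of_int s + \<alpha> / 2) * Gamma (real n - 1 + (\<delta> + \<alpha>) / 2))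
             / (Gamma (real n + 1) * Gamma (real n + 1 - of_int s + \<delta> / 2))
             * V x
             * jacobi_poly (nat (int n + 1 - s)) (\<alpha> / 2 - 2 + of_int s) (\<delta> / 2 - 1)
                 (2 * (norm x)\<^sup>2 - 1)"
  proof -
    have e1: "(- 1 :: real) powi (1 - s) = (-1) ^ k" by (simp add: s)
    have e2: "real n + 1 - of_int s + \<alpha> / 2 = real n + real k + 1 - h" by (simp add: s h_def)
    have e3: "real n - 1 + (\<delta> + \<alpha>) / 2 = real n + A"
      using N by (simp add: N_def h_def field_simps)
    have e4: "real n + 1 - of_int s + \<delta> / 2 = real n + real k + N" by (simp add: s N_def)
    have e5: "nat (int n + 1 - s) = n + k" by (simp add: s)
    have e6: "\<alpha> / 2 - 2 + of_int s = - real k - h" by (simp add: s h_def)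
    have e7: "Gamma (real n + 1) = fact n" by (simp add: Gamma_fact add.commute)
    show ?thesis unfolding sum e1 e2 e3 e4 e5 e6 e7
      by (simp add: N_def r_def mult_ac)
  qed
  finally show "integrable lborel (riesz_integrand (2 - \<alpha>) f x) \<and>
           riesz_potential (2 - \<alpha>) f x =
             (- 1) powi (1 - s) * 2 powr (\<alpha> - 2)
             * (Gamma (real n + 1 - of_int s + \<alpha> / 2) * Gamma (real n - 1 + (\<delta> + \<alpha>) / 2))
             / (Gamma (real n + 1) * Gamma (real n + 1 - of_int s + \<delta> / 2))
             * V x
             * jacobi_poly (nat (int n + 1 - s)) (\<alpha> / 2 - 2 + of_int s) (\<delta> / 2 - 1)
                 (2 * (norm x)\<^sup>2 - 1)"
    using main by (simp add: has_bochner_integral_iff)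
qed

end
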